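(* Let $X$ be a zero-dimensional compact metrizable space and $\Gamma$ a countable discrete group. Suppose $h:\Gamma\curvearrowright X$ is a continuous action with induced action $\alpha:\Gamma\rightarrow\operatorname{Aut}(C(X))$. Then the following statements are equivalent. (1) $\Gamma\curvearrowright X$ is residually finite. (2) Given finite subsets $S\subset K_{0}(C(X))^{+}$ and $F\subset\Gamma$, there exist $d\in\mathbb{N}$, an action $\sigma:\Gamma\rightarrow\operatorname{OAut}(\mathbb{Z}^{d})$ by ordered abelian group automorphisms, and a morphism of ordered abelian groups (with order units) $\beta:K_{0}(C(X))\rightarrow\mathbb{Z}^{d}$ such that (a) $\beta\circ\hat\alpha_{t}(g)=\sigma_{t}\circ\beta(g)$ for each $g\in S$ and $t\in F$, (b) $\beta(g)\neq 0$ for every $0\neq g\in S$. (3) Given finite subsets $S\subset K_{0}(C(X))^{+}$ and $F\subset\Gamma$, there exist $d\in\mathbb{N}$, a subgroup $H\leq K_{0}(C(X))$, an action $\sigma:\Gamma\rightarrow\operatorname{OAut}(\mathbb{Z}^{d})$ by ordered abelian group automorphisms, and a positive group homomorphism $\beta:H\rightarrow\mathbb{Z}^{d}$ such that (a) $[1]\in H$, $S_{F}\subset H$, and $\beta([1])=(1,1,\dots,1)$, (b) $\beta\circ\hat\alpha_{t}(g)=\sigma_{t}\circ\beta(g)$ for each $g\in S$ and $t\in F$, (c) $\beta(g)\neq 0$ for every $0\neq g\in S$.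
   Context: The induced action is $\alpha_s(f)(x)=f(s^{-1}.x)$ for $s\in\Gamma$, $f\in C(X)$, $x\in X$, and $\hat\alpha_s=K_0(\alpha_s)$ is the induced automorphism of $K_0(C(X))$. For a finite set $S\subset K_0(C(X))$ and $F\subset\Gamma$, $S_F:=\{\hat\alpha_t(x):x\in S,\ t\in F\cup\{e\}\}$. Residually finite action: let $\rho$ be a metric compatible with the topology of $X$. The action is residually finite if for every $\varepsilon>0$ and finite $F\subset\Gamma$ there are a finite set $E$ with an action of $\Gamma$ and a map $\zeta:E\to X$ such that $\rho(\zeta(s.z),s.\zeta(z))<\varepsilon$ for all $s\in F$, $z\in E$, and $\zeta(E)$ is $\varepsilon$-dense in $X$. Ordered abelian groups: a morphism $(G,G^+,u)\to(H,H^+,v)$ of ordered abelian groups with distinguished order units is a group homomorphism $\beta$ with $\beta(G^+)\subset H^+$ (positive) and $\beta(u)=v$. $\operatorname{OAut}(G)$ is the group of automorphisms $\tau$ of $G$ with $\tau(G^+)=G^+$ and $\tau(u)=u$. $\mathbb{Z}^d$ has positive cone $(\mathbb{Z}_{\ge0})^d$ and order unit $(1,\dots,1)$; $K_0(C(X))$ has its usual positive cone $K_0(C(X))^+$ (classes of projections in matrix algebras over $C(X)$) and order unit $[1]$. A subgroup $H\le K_0(C(X))$ carries the order with positive cone $H\cap K_0(C(X))^+$. *)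

theory Defs
  imports
    "HOL-Analysis.Abstract_Metric_Spaces"
    "HOL-Algebra.Product_Groups"
    "HOL-Algebra.Group_Action"
    "HOL-Algebra.Bij"
    "HOL-Library.Function_Algebras"
    "Jordan_Normal_Form.Matrix"
begin

section \<open>Dynamics\<close>

definition zero_dimensional_space :: "'a topology \<Rightarrow> bool" where
  "zero_dimensional_space X \<longleftrightarrow>
     (\<forall>U x. openin X U \<and> x \<in> U \<longrightarrow> (\<exists>V. openin X V \<and> closedin X V \<and> x \<in> V \<and> V \<subseteq> U))"

definition continuous_group_action ::
    "('g, 'm) monoid_scheme \<Rightarrow> 'a topology \<Rightarrow> ('g \<Rightarrow> 'a \<Rightarrow> 'a) \<Rightarrow> bool" where
  "continuous_group_action \<Gamma> X h \<longleftrightarrow>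
     group_action \<Gamma> (topspace X) h \<and> (\<forall>s\<in>carrier \<Gamma>. continuous_map X X (h s))"

text \<open>Every finite set is in bijection with a set of natural numbers, so letting the finite
  set \<open>E\<close> range over \<^typ>\<open>nat set\<close> is no restriction.\<close>

definition residually_finite_action ::
    "('g, 'm) monoid_scheme \<Rightarrow> 'a set \<Rightarrow> ('a \<Rightarrow> 'a \<Rightarrow> real) \<Rightarrow> ('g \<Rightarrow> 'a \<Rightarrow> 'a) \<Rightarrow> bool" where
  "residually_finite_action \<Gamma> M \<rho> h \<longleftrightarrow>
     (\<forall>\<epsilon>>0. \<forall>F. finite F \<and> F \<subseteq> carrier \<Gamma> \<longrightarrow>
        (\<exists>(E :: nat set) \<theta> \<zeta>. finite E \<and> group_action \<Gamma> E \<theta> \<and> \<zeta> \<in> E \<rightarrow> M \<and>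
           (\<forall>s\<in>F. \<forall>z\<in>E. \<rho> (\<zeta> (\<theta> s z)) (h s (\<zeta> z)) < \<epsilon>) \<and>
           (\<forall>x\<in>M. \<exists>z\<in>E. \<rho> (\<zeta> z) x < \<epsilon>)))"


section \<open>Ordered abelian groups with a distinguished order unit\<close>

record 'a ordered_group = "'a monoid" +
  pcone :: "'a set"
  ounit :: 'a

definition OAut :: "('a, 'm) ordered_group_scheme \<Rightarrow> ('a \<Rightarrow> 'a) monoid" where
  "OAut G = AutoGroup G
     \<lparr>carrier := {\<tau> \<in> auto G. \<tau> ` pcone G = pcone G \<and> \<tau> (ounit G) = ounit G}\<rparr>"

definition positive_hom ::
    "('a, 'm) ordered_group_scheme \<Rightarrow> ('b, 'n) ordered_group_scheme \<Rightarrow> ('a \<Rightarrow> 'b) set" where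
  "positive_hom G H = {\<beta> \<in> hom G H. \<beta> ` pcone G \<subseteq> pcone H}"

definition unital_positive_hom ::
    "('a, 'm) ordered_group_scheme \<Rightarrow> ('b, 'n) ordered_group_scheme \<Rightarrow> ('a \<Rightarrow> 'b) set" where
  "unital_positive_hom G H = {\<beta> \<in> positive_hom G H. \<beta> (ounit G) = ounit H}"

text \<open>The order unit is left untouched; it is only meaningful when it lies in \<open>H\<close>.\<close>

definition ordered_subgroup :: "'a ordered_group \<Rightarrow> 'a set \<Rightarrow> 'a ordered_group" where
  "ordered_subgroup G H = G \<lparr>carrier := H, pcone := H \<inter> pcone G\<rparr>"

definition Z_pow :: "nat \<Rightarrow> (nat \<Rightarrow> int) ordered_group" where
  "Z_pow d = monoid.extend (product_group {..<d} (\<lambda>_. integer_group))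
     \<lparr>pcone = {..<d} \<rightarrow>\<^sub>E {0..}, ounit = (\<lambda>i\<in>{..<d}. 1)\<rparr>"


section \<open>The algebra of continuous functions and its matrix algebras\<close>

text \<open>Functions on \<open>X\<close> are represented by functions on the ambient type that vanish off
  \<open>topspace X\<close>. The pointwise operations on the function type then restrict to those of
  \<open>C(X)\<close>, except that its unit is the indicator function of \<open>topspace X\<close>, and equality of
  matrices over \<open>C(X)\<close> is equality in the matrix type.\<close>

definition CX :: "'a topology \<Rightarrow> ('a \<Rightarrow> complex) set" where
  "CX X = {f. continuous_map X euclidean f \<and> (\<forall>x. x \<notin> topspace X \<longrightarrow> f x = 0)}"

definition CX_one :: "'a topology \<Rightarrow> 'a \<Rightarrow> complex" where
  "CX_one X = (\<lambda>x. if x \<in> topspace X then 1 else 0)"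

definition CX_action ::
    "('g, 'm) monoid_scheme \<Rightarrow> 'a topology \<Rightarrow> ('g \<Rightarrow> 'a \<Rightarrow> 'a)
      \<Rightarrow> 'g \<Rightarrow> ('a \<Rightarrow> complex) \<Rightarrow> 'a \<Rightarrow> complex" where
  "CX_action \<Gamma> X h s f = (\<lambda>x. if x \<in> topspace X then f (h (inv\<^bsub>\<Gamma>\<^esub> s) x) else 0)"

definition CX_mat :: "'a topology \<Rightarrow> nat \<Rightarrow> nat \<Rightarrow> ('a \<Rightarrow> complex) mat set" where
  "CX_mat X m n = {A \<in> carrier_mat m n. \<forall>i<m. \<forall>j<n. A $$ (i, j) \<in> CX X}"

definition star_mat :: "('a \<Rightarrow> complex) mat \<Rightarrow> ('a \<Rightarrow> complex) mat" where
  "star_mat A = map_mat (\<lambda>f x. cnj (f x)) (transpose_mat A)"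

definition mat_dsum :: "'b::zero mat \<Rightarrow> 'b mat \<Rightarrow> 'b mat" where
  "mat_dsum A B =
     four_block_mat A (0\<^sub>m (dim_row A) (dim_col B)) (0\<^sub>m (dim_row B) (dim_col A)) B"


section \<open>The ordered group \<open>K\<^sub>0(C(X))\<close>\<close>

definition Proj :: "'a topology \<Rightarrow> ('a \<Rightarrow> complex) mat set" where
  "Proj X = {p. \<exists>n. p \<in> CX_mat X n n \<and> p * p = p \<and> star_mat p = p}"

text \<open>Murray--von Neumann equivalence of projections of possibly different sizes, implemented
  by rectangular matrices.\<close>

definition MvN_equiv :: "'a topology \<Rightarrow> ('a \<Rightarrow> complex) mat \<Rightarrow> ('a \<Rightarrow> complex) mat \<Rightarrow> bool" where
  "MvN_equiv X p q \<longleftrightarrow>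
     (\<exists>v \<in> CX_mat X (dim_row q) (dim_row p). star_mat v * v = p \<and> v * star_mat v = q)"

text \<open>\<open>K\<^sub>0(C(X))\<close> is the Grothendieck group of the semigroup of Murray--von Neumann classes; the
  pair \<open>(p, q)\<close> stands for the formal difference \<open>[p] - [q]\<close>. As the semigroup need not be
  cancellative, the equivalence of pairs involves a further summand \<open>r\<close>.\<close>

type_synonym 'a K0_elem = "(('a \<Rightarrow> complex) mat \<times> ('a \<Rightarrow> complex) mat) set"

definition K0_rel :: "'a topology \<Rightarrow>
    ((('a \<Rightarrow> complex) mat \<times> ('a \<Rightarrow> complex) mat) \<times> (('a \<Rightarrow> complex) mat \<times> ('a \<Rightarrow> complex) mat)) set"
  where
  "K0_rel X = {((p, q), (p', q')). p \<in> Proj X \<and> q \<in> Proj X \<and> p' \<in> Proj X \<and> q' \<in> Proj X \<and>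
     (\<exists>r \<in> Proj X. MvN_equiv X (mat_dsum (mat_dsum p q') r) (mat_dsum (mat_dsum p' q) r))}"

definition K0_diff ::
    "'a topology \<Rightarrow> ('a \<Rightarrow> complex) mat \<Rightarrow> ('a \<Rightarrow> complex) mat \<Rightarrow> 'a K0_elem" where
  "K0_diff X p q = K0_rel X `` {(p, q)}"

definition K0_class :: "'a topology \<Rightarrow> ('a \<Rightarrow> complex) mat \<Rightarrow> 'a K0_elem" where
  "K0_class X p = K0_diff X p (0\<^sub>m 0 0)"

definition K0 :: "'a topology \<Rightarrow> 'a K0_elem ordered_group" where
  "K0 X = \<lparr>carrier = (Proj X \<times> Proj X) // K0_rel X,
           monoid.mult = (\<lambda>z w. \<Union>(p, q)\<in>z. \<Union>(p', q')\<in>w. K0_diff X (mat_dsum p p') (mat_dsum q q')),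
           one = K0_class X (0\<^sub>m 0 0),
           pcone = K0_class X ` Proj X,
           ounit = K0_class X (mat 1 1 (\<lambda>_. CX_one X))\<rparr>"

text \<open>The map induced on \<open>K\<^sub>0(C(X))\<close> by a unital \<open>*\<close>-endomorphism \<open>\<phi>\<close> of \<open>C(X)\<close>, which acts
  entrywise on matrices.\<close>

definition K0_map ::
    "'a topology \<Rightarrow> (('a \<Rightarrow> complex) \<Rightarrow> ('a \<Rightarrow> complex)) \<Rightarrow> 'a K0_elem \<Rightarrow> 'a K0_elem" where
  "K0_map X \<phi> z = (\<Union>(p, q)\<in>z. K0_diff X (map_mat \<phi> p) (map_mat \<phi> q))"

definition K0_action ::
    "('g, 'm) monoid_scheme \<Rightarrow> 'a topology \<Rightarrow> ('g \<Rightarrow> 'a \<Rightarrow> 'a) \<Rightarrow> 'g \<Rightarrow> 'a K0_elem \<Rightarrow> 'a K0_elem" where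
  "K0_action \<Gamma> X h s = K0_map X (CX_action \<Gamma> X h s)"

definition K0_translates ::
    "('g, 'm) monoid_scheme \<Rightarrow> 'a topology \<Rightarrow> ('g \<Rightarrow> 'a \<Rightarrow> 'a)
      \<Rightarrow> 'a K0_elem set \<Rightarrow> 'g set \<Rightarrow> 'a K0_elem set" where
  "K0_translates \<Gamma> X h S F = {K0_action \<Gamma> X h t x |x t. x \<in> S \<and> t \<in> F \<union> {\<one>\<^bsub>\<Gamma>\<^esub>}}"

end

theory Submission
  imports Defs "Jordan_Normal_Form.Schur_Decomposition"
begin

text \<open>The trace of a projection over \<open>C(X)\<close> is integer valued and continuous, so evaluating it at a
  point \<open>x\<close> gives a unital positive homomorphism \<open>K\<^sub>0(C(X)) \<rightarrow> \<int>\<close> that depends locally constantly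
  on \<open>x\<close>; on the positive cone these homomorphisms jointly detect zero. An approximately
  equivariant map \<open>\<zeta>\<close> from a finite \<open>\<Gamma>\<close>-set \<open>E\<close> to \<open>X\<close> thus induces \<open>\<beta> : K\<^sub>0(C(X)) \<rightarrow> \<int>\<^sup>E\<close> by evaluation
  at the points \<open>\<zeta>(z)\<close>, and \<open>\<beta>\<close> is exactly equivariant on a prescribed finite set.
  Conversely, order automorphisms of \<open>\<int>\<^sup>d\<close> permute the basis, so \<open>\<sigma>\<close> is an action on \<open>{..<d}\<close>.
  For a partition of \<open>X\<close> into small clopen sets, \<open>\<beta>\<close> sends their classes to \<open>0\<close>-\<open>1\<close> vectors adding up
  to \<open>(1,\<dots>,1)\<close>, so each \<open>i < d\<close> selects a cell, and \<open>\<zeta>(i)\<close> is chosen in it. By positivity two clopen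
  sets whose classes are both nonzero at \<open>i\<close> intersect, which yields approximate equivariance.\<close>

text \<open>The isomorphism of K_0(C(X)) with C(X, Z) is never established: the integer evaluations
  at points, and the additivity of classes of disjoint clopen sets, are all that is used.
  Approximate equivariance becomes exact because uniform continuity of the trace and integrality
  make the ranks of finitely many classes agree at any two points closer than some \<delta>. Zero is
  detected because the trace of a projection at a point is the squared Hilbert-Schmidt norm of its
  value there. The obstacle in passing from (3) to (1) is that \<beta> lives only on H, which is
  known to contain [1] and some translates but not the classes of intersections of clopen sets. So
  no intersection is ever evaluated: that two sets meet is shown by contradiction, and the one extra
  class this requires, that of the complement of a disjoint union, is a difference of elements of H.
  Since \<alpha> acts by composition with the inverse, t is matched with the inverse of t both on X
  and on the coordinates of \<int>^d.\<close>

lemma sum_fun_apply: "sum f A x = (\<Sum>a\<in>A. f a x)"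
  by (induction A rule: infinite_finite_induct) auto

text \<open>Entries are functions, so a product entry has to be evaluated at a point before ordinary
  sums of complex numbers appear. Later proofs remove \<open>index_mult_mat(1)\<close> from the
  simpset to let this form win.\<close>

lemma mult_mat_index_apply:
  fixes A B :: "('a \<Rightarrow> complex) mat"
  assumes "i < dim_row A" "j < dim_col B" "dim_col A = dim_row B"
  shows "((A * B) $$ (i, j)) x = (\<Sum>k<dim_row B. (A $$ (i, k)) x * (B $$ (k, j)) x)"
  using assms by (simp add: scalar_prod_def sum_fun_apply lessThan_atLeast0)

text \<open>Side conditions on dimensions, instead of membership in \<open>carrier_mat\<close>, make
  this usable as a conditional rewrite rule.\<close>

lemma mat_mult_assoc:
  fixes A B C :: "'a::semiring_0 mat"
  shows "dim_col A = dim_row B \<Longrightarrow> dim_col B = dim_row C \<Longrightarrow> A * B * C = A * (B * C)"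
  by (rule assoc_mult_mat[of A "dim_row A" "dim_row B" B "dim_row C" C "dim_col C"]) auto

section \<open>Matrices over \<open>C(X)\<close>\<close>

lemma dim_star_mat [simp]: "dim_row (star_mat A) = dim_col A" "dim_col (star_mat A) = dim_row A"
  by (auto simp: star_mat_def)

lemma star_mat_index [simp]:
  "i < dim_col A \<Longrightarrow> j < dim_row A \<Longrightarrow> star_mat A $$ (i, j) = (\<lambda>x. cnj ((A $$ (j, i)) x))"
  by (auto simp: star_mat_def)

lemma star_mat_carrier [simp, intro]: "A \<in> carrier_mat m n \<Longrightarrow> star_mat A \<in> carrier_mat n m"
  by (auto simp: star_mat_def)

lemma star_star_mat [simp]: "star_mat (star_mat A) = A"
  by (rule eq_matI) auto

lemma star_zero_mat [simp]: "star_mat (0\<^sub>m m n) = 0\<^sub>m n m"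
  by (rule eq_matI) (auto simp: zero_fun_def)

lemma star_mult_mat:
  assumes "dim_col A = dim_row B"
  shows "star_mat (A * B) = star_mat B * star_mat A"
proof (rule eq_matI)
  fix i j assume "i < dim_row (star_mat B * star_mat A)" "j < dim_col (star_mat B * star_mat A)"
  then show "star_mat (A * B) $$ (i, j) = (star_mat B * star_mat A) $$ (i, j)"
    using assms by (auto simp: mult_mat_index_apply mult.commute simp del: index_mult_mat(1))
qed auto

lemma star_four_block_mat:
  assumes "A \<in> carrier_mat m n" "B \<in> carrier_mat m n'" "C \<in> carrier_mat m' n" "D \<in> carrier_mat m' n'"
  shows "star_mat (four_block_mat A B C D) =
    four_block_mat (star_mat A) (star_mat C) (star_mat B) (star_mat D)"
  unfolding star_mat_def transpose_four_block_mat[OF assms]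
  by (rule map_four_block_mat) (use assms in auto)

lemma dim_mat_dsum [simp]:
  "dim_row (mat_dsum A B) = dim_row A + dim_row B" "dim_col (mat_dsum A B) = dim_col A + dim_col B"
  by (auto simp: mat_dsum_def)

text \<open>Direct sums are associative on the nose, and the empty matrix is a strict unit. Among
  the laws of a commutative monoid only commutativity will need Murray-von Neumann
  equivalence.\<close>

lemma mat_dsum_assoc: "mat_dsum (mat_dsum A B) C = mat_dsum A (mat_dsum B C)"
  unfolding mat_dsum_def by (rule assoc_four_block_mat[symmetric])

lemma mat_dsum_zero [simp]: "mat_dsum (0\<^sub>m 0 0) A = A"  "mat_dsum A (0\<^sub>m 0 0) = A"
  by (auto simp: mat_dsum_def intro!: eq_matI)

lemma star_mat_dsum: "star_mat (mat_dsum A B) = mat_dsum (star_mat A) (star_mat B)"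
  by (simp add: mat_dsum_def star_four_block_mat[where m="dim_row A" and n="dim_col A" and n'="dim_col B" and m'="dim_row B"])

lemma mat_dsum_mult:
  fixes A B C D :: "'a::semiring_0 mat"
  assumes "dim_col A = dim_row C" "dim_col B = dim_row D"
  shows "mat_dsum A B * mat_dsum C D = mat_dsum (A * C) (B * D)"
proof -
  have "mat_dsum A B * mat_dsum C D =
     four_block_mat (A * C + 0\<^sub>m (dim_row A) (dim_col B) * 0\<^sub>m (dim_row D) (dim_col C))
       (A * 0\<^sub>m (dim_row C) (dim_col D) + 0\<^sub>m (dim_row A) (dim_col B) * D)
       (0\<^sub>m (dim_row B) (dim_col A) * C + B * 0\<^sub>m (dim_row D) (dim_col C))
       (0\<^sub>m (dim_row B) (dim_col A) * 0\<^sub>m (dim_row C) (dim_col D) + B * D)"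
    unfolding mat_dsum_def
    by (rule mult_four_block_mat) (use assms in auto)
  also have "\<dots> = mat_dsum (A * C) (B * D)"
    using assms by (auto simp: mat_dsum_def intro!: cong_four_block_mat)
  finally show ?thesis .
qed

lemma CX_zero [simp]: "0 \<in> CX X"
  by (auto simp: CX_def zero_fun_def)

lemma CX_add: "f \<in> CX X \<Longrightarrow> g \<in> CX X \<Longrightarrow> f + g \<in> CX X"
  by (auto simp: CX_def plus_fun_def intro: continuous_map_add)

lemma CX_mult: "f \<in> CX X \<Longrightarrow> g \<in> CX X \<Longrightarrow> f * g \<in> CX X"
  by (auto simp: CX_def times_fun_def continuous_map_atin intro: tendsto_mult)

lemma CX_sum: "(\<And>a. a \<in> A \<Longrightarrow> f a \<in> CX X) \<Longrightarrow> sum f A \<in> CX X"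
  by (induction A rule: infinite_finite_induct) (auto simp: CX_add)

lemma CX_cnj: "f \<in> CX X \<Longrightarrow> (\<lambda>x. cnj (f x)) \<in> CX X"
  by (auto simp: CX_def continuous_map_atin intro: tendsto_cnj)

lemma CX_matD: "A \<in> CX_mat X m n \<Longrightarrow> A \<in> carrier_mat m n"
  by (simp add: CX_mat_def)

lemma CX_mat_zero [simp, intro]: "0\<^sub>m m n \<in> CX_mat X m n"
  by (auto simp: CX_mat_def)

lemma CX_mat_star: "A \<in> CX_mat X m n \<Longrightarrow> star_mat A \<in> CX_mat X n m"
  by (auto simp: CX_mat_def CX_cnj)

lemma CX_mat_mult: "A \<in> CX_mat X m k \<Longrightarrow> B \<in> CX_mat X k n \<Longrightarrow> A * B \<in> CX_mat X m n"
  by (auto simp: CX_mat_def scalar_prod_def intro!: CX_sum CX_mult)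

lemma CX_mat_four_block:
  assumes "A \<in> CX_mat X m n" "B \<in> CX_mat X m n'" "C \<in> CX_mat X m' n" "D \<in> CX_mat X m' n'"
  shows "four_block_mat A B C D \<in> CX_mat X (m + m') (n + n')"
  using assms by (auto simp: CX_mat_def)

lemma CX_mat_dsum:
  assumes "A \<in> CX_mat X m n" "B \<in> CX_mat X m' n'"
  shows "mat_dsum A B \<in> CX_mat X (m + m') (n + n')"
  unfolding mat_dsum_def by (rule CX_mat_four_block) (use assms in \<open>auto simp: CX_mat_def\<close>)

section \<open>The monoid of Murray--von Neumann classes\<close>

lemma ProjD:
  assumes "p \<in> Proj X"
  shows "p \<in> CX_mat X (dim_row p) (dim_row p)" "p \<in> carrier_mat (dim_row p) (dim_row p)"
    "dim_col p = dim_row p" "p * p = p" "star_mat p = p"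
  using assms by (auto simp: Proj_def CX_mat_def)

lemma Proj_dsum:
  assumes "p \<in> Proj X" "q \<in> Proj X"
  shows "mat_dsum p q \<in> Proj X"
proof -
  note P = ProjD[OF assms(1)] and Q = ProjD[OF assms(2)]
  have "mat_dsum p q * mat_dsum p q = mat_dsum p q" "star_mat (mat_dsum p q) = mat_dsum p q"
    by (simp_all add: mat_dsum_mult star_mat_dsum P(3-5) Q(3-5))
  with CX_mat_dsum[OF P(1) Q(1)] show ?thesis unfolding Proj_def by blast
qed

lemma Proj_zero [simp, intro]: "0\<^sub>m n n \<in> Proj X"
  by (auto simp: Proj_def)

lemma MvN_equiv_refl: "p \<in> Proj X \<Longrightarrow> MvN_equiv X p p"
  unfolding MvN_equiv_def by (metis ProjD(1,4,5))

lemma MvN_equiv_sym: "MvN_equiv X p q \<Longrightarrow> MvN_equiv X q p"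
  unfolding MvN_equiv_def by (metis CX_mat_star star_star_mat)

text \<open>The product \<open>w * v\<close> implements the equivalence. In each of its two squares
  the inner factor is \<open>q\<close>; rewriting \<open>q\<close> through the other matrix leaves
  \<open>p * p\<close> or \<open>r * r\<close>.\<close>

lemma MvN_equiv_trans:
  assumes "MvN_equiv X p q" "MvN_equiv X q r" "p \<in> Proj X" "q \<in> Proj X" "r \<in> Proj X"
  shows "MvN_equiv X p r"
proof -
  note P = ProjD[OF assms(3)] and Q = ProjD[OF assms(4)] and R = ProjD[OF assms(5)]
  obtain v where v: "v \<in> CX_mat X (dim_row q) (dim_row p)" "star_mat v * v = p" "v * star_mat v = q"
    using assms(1) by (auto simp: MvN_equiv_def)
  obtain w where w: "w \<in> CX_mat X (dim_row r) (dim_row q)" "star_mat w * w = q" "w * star_mat w = r"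
    using assms(2) by (auto simp: MvN_equiv_def)
  have vc: "v \<in> carrier_mat (dim_row q) (dim_row p)" "star_mat v \<in> carrier_mat (dim_row p) (dim_row q)"
    and wc: "w \<in> carrier_mat (dim_row r) (dim_row q)" "star_mat w \<in> carrier_mat (dim_row q) (dim_row r)"
    using v w by (auto dest: CX_matD)
  have st: "star_mat (w * v) = star_mat v * star_mat w"
    using vc wc by (simp add: star_mult_mat)
  have "star_mat (w * v) * (w * v) = star_mat v * (star_mat w * w) * v"
    using vc wc by (simp add: st mat_mult_assoc)
  also have "\<dots> = (star_mat v * v) * (star_mat v * v)"
    unfolding w(2) v(3)[symmetric] using vc by (simp add: mat_mult_assoc)
  finally have 1: "star_mat (w * v) * (w * v) = p" by (simp only: v(2) P(4))
  have "(w * v) * star_mat (w * v) = w * (v * star_mat v) * star_mat w"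
    using vc wc by (simp add: st mat_mult_assoc)
  also have "\<dots> = (w * star_mat w) * (w * star_mat w)"
    unfolding v(3) w(2)[symmetric] using wc by (simp add: mat_mult_assoc)
  finally have 2: "(w * v) * star_mat (w * v) = r" by (simp only: w(3) R(4))
  show ?thesis unfolding MvN_equiv_def
    using 1 2 v(1) w(1) by (blast intro: CX_mat_mult)
qed

lemma MvN_equiv_dsum:
  assumes "MvN_equiv X p q" "MvN_equiv X p' q'"
  shows "MvN_equiv X (mat_dsum p p') (mat_dsum q q')"
proof -
  obtain v where v: "v \<in> CX_mat X (dim_row q) (dim_row p)" "star_mat v * v = p" "v * star_mat v = q"
    using assms(1) by (auto simp: MvN_equiv_def)
  obtain w where w: "w \<in> CX_mat X (dim_row q') (dim_row p')" "star_mat w * w = p'" "w * star_mat w = q'"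
    using assms(2) by (auto simp: MvN_equiv_def)
  have dims: "dim_row v = dim_row q" "dim_col v = dim_row p" "dim_row w = dim_row q'" "dim_col w = dim_row p'"
    using CX_matD[OF v(1)] CX_matD[OF w(1)] by auto
  have "star_mat (mat_dsum v w) * mat_dsum v w = mat_dsum (star_mat v * v) (star_mat w * w)"
    "mat_dsum v w * star_mat (mat_dsum v w) = mat_dsum (v * star_mat v) (w * star_mat w)"
    by (simp_all add: star_mat_dsum mat_dsum_mult dims)
  then show ?thesis
    unfolding MvN_equiv_def dim_mat_dsum v(2,3) w(2,3) using CX_mat_dsum[OF v(1) w(1)] by blast
qed

lemma MvN_equiv_dsum_commute:
  assumes "p \<in> Proj X" "q \<in> Proj X"
  shows "MvN_equiv X (mat_dsum p q) (mat_dsum q p)"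
proof -
  note P = ProjD[OF assms(1)] and Q = ProjD[OF assms(2)]
  let ?m = "dim_row p" and ?n = "dim_row q"
  \<comment> \<open>The flip of the two summands, cut down by p and q. With identity blocks the two
    products would be identity matrices instead of the two direct sums.\<close>
  define v where "v = four_block_mat (0\<^sub>m ?n ?m) q p (0\<^sub>m ?m ?n)"
  have st: "star_mat v = four_block_mat (0\<^sub>m ?m ?n) p q (0\<^sub>m ?n ?m)"
    unfolding v_def star_four_block_mat[OF zero_carrier_mat Q(2) P(2) zero_carrier_mat]
    by (simp only: star_zero_mat P(5) Q(5))
  have "star_mat v * v = four_block_mat (0\<^sub>m ?m ?n * 0\<^sub>m ?n ?m + p * p) (0\<^sub>m ?m ?n * q + p * 0\<^sub>m ?m ?n)
      (q * 0\<^sub>m ?n ?m + 0\<^sub>m ?n ?m * p) (q * q + 0\<^sub>m ?n ?m * 0\<^sub>m ?m ?n)"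
    unfolding st unfolding v_def by (rule mult_four_block_mat) (fact P(2) Q(2) zero_carrier_mat)+
  then have 1: "star_mat v * v = mat_dsum p q"
    by (simp add: mat_dsum_def P(2-4) Q(2-4) left_add_zero_mat[OF P(2)] right_add_zero_mat[OF Q(2)]
        left_mult_zero_mat[OF P(2)] left_mult_zero_mat[OF Q(2)] right_mult_zero_mat[OF P(2)] right_mult_zero_mat[OF Q(2)])
  have "v * star_mat v = four_block_mat (0\<^sub>m ?n ?m * 0\<^sub>m ?m ?n + q * q) (0\<^sub>m ?n ?m * p + q * 0\<^sub>m ?n ?m)
      (p * 0\<^sub>m ?m ?n + 0\<^sub>m ?m ?n * q) (p * p + 0\<^sub>m ?m ?n * 0\<^sub>m ?n ?m)"
    unfolding st unfolding v_def by (rule mult_four_block_mat) (fact P(2) Q(2) zero_carrier_mat)+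
  then have 2: "v * star_mat v = mat_dsum q p"
    by (simp add: mat_dsum_def P(2-4) Q(2-4) left_add_zero_mat[OF Q(2)] right_add_zero_mat[OF P(2)]
        left_mult_zero_mat[OF P(2)] left_mult_zero_mat[OF Q(2)] right_mult_zero_mat[OF P(2)] right_mult_zero_mat[OF Q(2)])
  have "v \<in> CX_mat X (?n + ?m) (?m + ?n)"
    unfolding v_def by (rule CX_mat_four_block[OF CX_mat_zero Q(1) P(1) CX_mat_zero])
  with 1 2 show ?thesis unfolding MvN_equiv_def by auto
qed

definition MvN_class :: "'a topology \<Rightarrow> ('a \<Rightarrow> complex) mat \<Rightarrow> ('a \<Rightarrow> complex) mat set" where
  "MvN_class X p = {q \<in> Proj X. MvN_equiv X p q}"

text \<open>Passing to classes replaces equivalence by equality, so that the Grothendieck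
  construction becomes a calculation with \<open>m_ac\<close>. The choice of representatives is
  harmless by \<open>MvN_equiv_dsum\<close>, as \<open>MvN_class_dsum\<close> records.\<close>

definition MvN_monoid :: "'a topology \<Rightarrow> ('a \<Rightarrow> complex) mat set monoid" where
  "MvN_monoid X = \<lparr>carrier = MvN_class X ` Proj X,
     monoid.mult = (\<lambda>a b. MvN_class X (mat_dsum (SOME p. p \<in> a) (SOME q. q \<in> b))),
     one = MvN_class X (0\<^sub>m 0 0)\<rparr>"

lemma MvN_class_eq_iff:
  assumes "p \<in> Proj X" "q \<in> Proj X"
  shows "MvN_class X p = MvN_class X q \<longleftrightarrow> MvN_equiv X p q"
proof
  assume "MvN_class X p = MvN_class X q"
  then have "q \<in> MvN_class X p" using assms by (auto simp: MvN_class_def MvN_equiv_refl)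
  then show "MvN_equiv X p q" by (simp add: MvN_class_def)
next
  assume "MvN_equiv X p q"
  then show "MvN_class X p = MvN_class X q"
    using assms unfolding MvN_class_def by (blast intro: MvN_equiv_trans MvN_equiv_sym)
qed

lemma MvN_class_closed [simp, intro]: "p \<in> Proj X \<Longrightarrow> MvN_class X p \<in> carrier (MvN_monoid X)"
  by (simp add: MvN_monoid_def)

lemma MvN_class_dsum:
  assumes "p \<in> Proj X" "q \<in> Proj X"
  shows "MvN_class X (mat_dsum p q) = MvN_class X p \<otimes>\<^bsub>MvN_monoid X\<^esub> MvN_class X q"
proof -
  have "p \<in> MvN_class X p" "q \<in> MvN_class X q"
    using assms by (auto simp: MvN_class_def MvN_equiv_refl)
  then have "(SOME p'. p' \<in> MvN_class X p) \<in> MvN_class X p" "(SOME q'. q' \<in> MvN_class X q) \<in> MvN_class X q"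
    by (auto intro: someI)
  then have "MvN_equiv X (mat_dsum p q) (mat_dsum (SOME p'. p' \<in> MvN_class X p) (SOME p'. p' \<in> MvN_class X q))"
    "(SOME p'. p' \<in> MvN_class X p) \<in> Proj X" "(SOME p'. p' \<in> MvN_class X q) \<in> Proj X"
    by (auto simp: MvN_class_def intro: MvN_equiv_dsum)
  then show ?thesis using assms
    by (simp add: MvN_monoid_def MvN_class_eq_iff Proj_dsum)
qed

lemma comm_monoid_MvN: "comm_monoid (MvN_monoid X)"
proof -
  have c: "a \<in> carrier (MvN_monoid X) \<longleftrightarrow> (\<exists>p\<in>Proj X. a = MvN_class X p)" for a
    by (auto simp: MvN_monoid_def)
  have o: "\<one>\<^bsub>MvN_monoid X\<^esub> = MvN_class X (0\<^sub>m 0 0)" by (simp add: MvN_monoid_def)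
  show ?thesis
  proof (rule comm_monoidI)
    fix a b assume "a \<in> carrier (MvN_monoid X)" "b \<in> carrier (MvN_monoid X)"
    then obtain p q where "p \<in> Proj X" "q \<in> Proj X" "a = MvN_class X p" "b = MvN_class X q"
      by (auto simp: c)
    then show "a \<otimes>\<^bsub>MvN_monoid X\<^esub> b = b \<otimes>\<^bsub>MvN_monoid X\<^esub> a"
      by (simp add: MvN_class_dsum[symmetric] MvN_class_eq_iff Proj_dsum MvN_equiv_dsum_commute)
  qed (auto simp: c o MvN_class_dsum[symmetric] Proj_dsum mat_dsum_assoc intro: Proj_dsum Proj_zero)
qed

section \<open>The group \<open>K\<^sub>0(C(X))\<close>\<close>

text \<open>The defining relation of the Grothendieck group, with the auxiliary projection r turned
  into an arbitrary element m of the monoid of classes.\<close>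

lemma K0_rel_iff:
  "((p, q), (p', q')) \<in> K0_rel X \<longleftrightarrow> p \<in> Proj X \<and> q \<in> Proj X \<and> p' \<in> Proj X \<and> q' \<in> Proj X \<and>
    (\<exists>m \<in> carrier (MvN_monoid X).
      MvN_class X p \<otimes>\<^bsub>MvN_monoid X\<^esub> MvN_class X q' \<otimes>\<^bsub>MvN_monoid X\<^esub> m =
      MvN_class X p' \<otimes>\<^bsub>MvN_monoid X\<^esub> MvN_class X q \<otimes>\<^bsub>MvN_monoid X\<^esub> m)"
proof -
  have "carrier (MvN_monoid X) = MvN_class X ` Proj X" by (simp add: MvN_monoid_def)
  then show ?thesis
    by (auto simp: K0_rel_def MvN_class_dsum[symmetric] Proj_dsum MvN_class_eq_iff)
qed

lemma equiv_K0_rel: "equiv (Proj X \<times> Proj X) (K0_rel X)"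
proof (rule equivI)
  interpret V: comm_monoid "MvN_monoid X" by (rule comm_monoid_MvN)
  show "K0_rel X \<subseteq> (Proj X \<times> Proj X) \<times> (Proj X \<times> Proj X)" by (auto simp: K0_rel_def)
  show "refl_on (Proj X \<times> Proj X) (K0_rel X)"
    by (auto simp: refl_on_def K0_rel_iff)
  show "sym (K0_rel X)"
    by (auto simp: sym_def K0_rel_iff)
  show "trans (K0_rel X)"
  proof (rule transI; clarify)
    fix p q p' q' p'' q''
    assume "((p, q), (p', q')) \<in> K0_rel X" "((p', q'), (p'', q'')) \<in> K0_rel X"
    then obtain m n where P: "p \<in> Proj X" "q \<in> Proj X" "p' \<in> Proj X" "q' \<in> Proj X" "p'' \<in> Proj X" "q'' \<in> Proj X"
      and mn: "m \<in> carrier (MvN_monoid X)" "n \<in> carrier (MvN_monoid X)"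
      and 1: "MvN_class X p \<otimes>\<^bsub>MvN_monoid X\<^esub> MvN_class X q' \<otimes>\<^bsub>MvN_monoid X\<^esub> m =
      MvN_class X p' \<otimes>\<^bsub>MvN_monoid X\<^esub> MvN_class X q \<otimes>\<^bsub>MvN_monoid X\<^esub> m"
      and 2: "MvN_class X p' \<otimes>\<^bsub>MvN_monoid X\<^esub> MvN_class X q'' \<otimes>\<^bsub>MvN_monoid X\<^esub> n =
      MvN_class X p'' \<otimes>\<^bsub>MvN_monoid X\<^esub> MvN_class X q' \<otimes>\<^bsub>MvN_monoid X\<^esub> n"
      by (auto simp: K0_rel_iff)
    \<comment> \<open>The classes of p' and q' cannot be cancelled, so they move into the auxiliary
      summand together with m and n.\<close>
    let ?r = "MvN_class X p' \<otimes>\<^bsub>MvN_monoid X\<^esub> MvN_class X q' \<otimes>\<^bsub>MvN_monoid X\<^esub> m \<otimes>\<^bsub>MvN_monoid X\<^esub> n"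
    have "MvN_class X p \<otimes>\<^bsub>MvN_monoid X\<^esub> MvN_class X q'' \<otimes>\<^bsub>MvN_monoid X\<^esub> ?r =
      (MvN_class X p \<otimes>\<^bsub>MvN_monoid X\<^esub> MvN_class X q' \<otimes>\<^bsub>MvN_monoid X\<^esub> m) \<otimes>\<^bsub>MvN_monoid X\<^esub>
      (MvN_class X p' \<otimes>\<^bsub>MvN_monoid X\<^esub> MvN_class X q'' \<otimes>\<^bsub>MvN_monoid X\<^esub> n)"
      using P mn by (simp add: V.m_ac)
    also have "\<dots> = MvN_class X p'' \<otimes>\<^bsub>MvN_monoid X\<^esub> MvN_class X q \<otimes>\<^bsub>MvN_monoid X\<^esub> ?r"
      unfolding 1 2 using P mn by (simp add: V.m_ac)
    finally show "((p, q), (p'', q'')) \<in> K0_rel X"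
      using P mn unfolding K0_rel_iff by (intro conjI bexI[of _ ?r]) auto
  qed
qed

lemma K0_diff_eq_iff:
  assumes "p \<in> Proj X" "q \<in> Proj X" "p' \<in> Proj X" "q' \<in> Proj X"
  shows "K0_diff X p q = K0_diff X p' q' \<longleftrightarrow> ((p, q), (p', q')) \<in> K0_rel X"
  unfolding K0_diff_def using assms by (auto intro!: eq_equiv_class_iff[OF equiv_K0_rel])

lemma K0_diff_closed [simp, intro]: "p \<in> Proj X \<Longrightarrow> q \<in> Proj X \<Longrightarrow> K0_diff X p q \<in> carrier (K0 X)"
  by (auto simp: K0_def K0_diff_def intro: quotientI)

lemma carrier_K0E:
  assumes "z \<in> carrier (K0 X)"
  obtains p q where "p \<in> Proj X" "q \<in> Proj X" "z = K0_diff X p q"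
  using assms by (auto simp: K0_def K0_diff_def elim!: quotientE)

lemma K0_diff_eqI:
  assumes "p \<in> Proj X" "q \<in> Proj X" "p' \<in> Proj X" "q' \<in> Proj X"
    and "MvN_class X p \<otimes>\<^bsub>MvN_monoid X\<^esub> MvN_class X q' = MvN_class X p' \<otimes>\<^bsub>MvN_monoid X\<^esub> MvN_class X q"
  shows "K0_diff X p q = K0_diff X p' q'"
proof -
  interpret V: comm_monoid "MvN_monoid X" by (rule comm_monoid_MvN)
  show ?thesis using assms by (auto simp: K0_diff_eq_iff K0_rel_iff)
qed

text \<open>Operations on K_0 are unions over all representatives. Such a union collapses to its
  value at one representative once the operation is constant on the class.\<close>

lemma UN_K0_diff:
  assumes "p \<in> Proj X" "q \<in> Proj X"
    and "\<And>p' q'. ((p, q), (p', q')) \<in> K0_rel X \<Longrightarrow> f p' q' = f p q"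
  shows "(\<Union>(p', q')\<in>K0_diff X p q. f p' q') = f p q"
proof -
  have "(p, q) \<in> K0_diff X p q"
    using equiv_class_self[OF equiv_K0_rel, of "(p, q)" X] assms(1,2) by (simp add: K0_diff_def)
  moreover have "f p' q' = f p q" if "(p', q') \<in> K0_diff X p q" for p' q'
    using that assms(3) by (auto simp: K0_diff_def)
  ultimately show ?thesis by blast
qed

text \<open>Replacing both representatives at once costs the sum of the two auxiliary elements m and
  n. The nested union is then collapsed from the inside out.\<close>

lemma K0_mult:
  assumes "p \<in> Proj X" "q \<in> Proj X" "p' \<in> Proj X" "q' \<in> Proj X"
  shows "K0_diff X p q \<otimes>\<^bsub>K0 X\<^esub> K0_diff X p' q' = K0_diff X (mat_dsum p p') (mat_dsum q q')"
proof -
  interpret V: comm_monoid "MvN_monoid X" by (rule comm_monoid_MvN)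
  have cong: "K0_diff X (mat_dsum a a') (mat_dsum b b') = K0_diff X (mat_dsum p p') (mat_dsum q q')"
    if "((p, q), (a, b)) \<in> K0_rel X" "((p', q'), (a', b')) \<in> K0_rel X" for a b a' b'
  proof -
    from that obtain m n where P: "a \<in> Proj X" "b \<in> Proj X" "a' \<in> Proj X" "b' \<in> Proj X"
      and mn: "m \<in> carrier (MvN_monoid X)" "n \<in> carrier (MvN_monoid X)"
      and 1: "MvN_class X p \<otimes>\<^bsub>MvN_monoid X\<^esub> MvN_class X b \<otimes>\<^bsub>MvN_monoid X\<^esub> m =
        MvN_class X a \<otimes>\<^bsub>MvN_monoid X\<^esub> MvN_class X q \<otimes>\<^bsub>MvN_monoid X\<^esub> m"
      and 2: "MvN_class X p' \<otimes>\<^bsub>MvN_monoid X\<^esub> MvN_class X b' \<otimes>\<^bsub>MvN_monoid X\<^esub> n =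
        MvN_class X a' \<otimes>\<^bsub>MvN_monoid X\<^esub> MvN_class X q' \<otimes>\<^bsub>MvN_monoid X\<^esub> n"
      by (auto simp: K0_rel_iff)
    let ?C = "MvN_class X"
    have "?C a \<otimes>\<^bsub>MvN_monoid X\<^esub> ?C a' \<otimes>\<^bsub>MvN_monoid X\<^esub> (?C q \<otimes>\<^bsub>MvN_monoid X\<^esub> ?C q') \<otimes>\<^bsub>MvN_monoid X\<^esub> (m \<otimes>\<^bsub>MvN_monoid X\<^esub> n)
      = (?C a \<otimes>\<^bsub>MvN_monoid X\<^esub> ?C q \<otimes>\<^bsub>MvN_monoid X\<^esub> m) \<otimes>\<^bsub>MvN_monoid X\<^esub> (?C a' \<otimes>\<^bsub>MvN_monoid X\<^esub> ?C q' \<otimes>\<^bsub>MvN_monoid X\<^esub> n)"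
      using P mn assms by (simp add: V.m_ac)
    also have "\<dots> = ?C p \<otimes>\<^bsub>MvN_monoid X\<^esub> ?C p' \<otimes>\<^bsub>MvN_monoid X\<^esub> (?C b \<otimes>\<^bsub>MvN_monoid X\<^esub> ?C b') \<otimes>\<^bsub>MvN_monoid X\<^esub> (m \<otimes>\<^bsub>MvN_monoid X\<^esub> n)"
      unfolding 1[symmetric] 2[symmetric] using P mn assms by (simp add: V.m_ac)
    finally show ?thesis
      using P mn assms unfolding K0_diff_eq_iff[OF Proj_dsum[OF P(1,3)] Proj_dsum[OF P(2,4)]
        Proj_dsum[OF assms(1,3)] Proj_dsum[OF assms(2,4)]]
      by (auto simp only: K0_rel_iff Proj_dsum MvN_class_dsum intro!: V.m_closed)
  qed
  have self: "((p, q), (p, q)) \<in> K0_rel X" "((p', q'), (p', q')) \<in> K0_rel X"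
    using assms by (auto simp: K0_diff_eq_iff[symmetric])
  have inner: "(\<Union>(a', b')\<in>K0_diff X p' q'. K0_diff X (mat_dsum a a') (mat_dsum b b'))
      = K0_diff X (mat_dsum p p') (mat_dsum q q')" if "((p, q), (a, b)) \<in> K0_rel X" for a b
    using UN_K0_diff[OF assms(3,4), of "\<lambda>a' b'. K0_diff X (mat_dsum a a') (mat_dsum b b')"]
      cong[OF that] self(2) by simp
  show ?thesis
    using UN_K0_diff[OF assms(1,2),
        of "\<lambda>a b. \<Union>(a', b')\<in>K0_diff X p' q'. K0_diff X (mat_dsum a a') (mat_dsum b b')"]
      inner self(1) by (simp add: K0_def)
qed

lemma comm_group_K0: "comm_group (K0 X)"
proof -
  interpret V: comm_monoid "MvN_monoid X" by (rule comm_monoid_MvN)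
  have o: "\<one>\<^bsub>K0 X\<^esub> = K0_diff X (0\<^sub>m 0 0) (0\<^sub>m 0 0)" by (simp add: K0_def K0_class_def)
  have comm: "K0_diff X (mat_dsum p p') (mat_dsum q q') = K0_diff X (mat_dsum p' p) (mat_dsum q' q)"
    if "p \<in> Proj X" "q \<in> Proj X" "p' \<in> Proj X" "q' \<in> Proj X" for p q p' q'
    by (rule K0_diff_eqI) (use that in \<open>auto simp: Proj_dsum MvN_class_dsum V.m_ac\<close>)
  have inv: "K0_diff X (mat_dsum q p) (mat_dsum p q) = K0_diff X (0\<^sub>m 0 0) (0\<^sub>m 0 0)"
    if "p \<in> Proj X" "q \<in> Proj X" for p q
    by (rule K0_diff_eqI) (use that in \<open>auto simp: Proj_dsum MvN_class_dsum V.m_ac\<close>)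
  show ?thesis
  proof (rule comm_groupI)
    fix z w assume zw: "z \<in> carrier (K0 X)" "w \<in> carrier (K0 X)"
    obtain p q where z: "p \<in> Proj X" "q \<in> Proj X" "z = K0_diff X p q" by (rule carrier_K0E[OF zw(1)])
    obtain p' q' where w: "p' \<in> Proj X" "q' \<in> Proj X" "w = K0_diff X p' q'" by (rule carrier_K0E[OF zw(2)])
    show "z \<otimes>\<^bsub>K0 X\<^esub> w \<in> carrier (K0 X)"
      using z w by (simp add: K0_mult Proj_dsum K0_diff_closed)
    show "z \<otimes>\<^bsub>K0 X\<^esub> w = w \<otimes>\<^bsub>K0 X\<^esub> z"
      using comm[OF z(1,2) w(1,2)] z w by (simp add: K0_mult)
    fix u assume "u \<in> carrier (K0 X)"
    then obtain p'' q'' where "p'' \<in> Proj X" "q'' \<in> Proj X" "u = K0_diff X p'' q''" by (rule carrier_K0E)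
    then show "z \<otimes>\<^bsub>K0 X\<^esub> w \<otimes>\<^bsub>K0 X\<^esub> u = z \<otimes>\<^bsub>K0 X\<^esub> (w \<otimes>\<^bsub>K0 X\<^esub> u)"
      using z w by (simp add: K0_mult Proj_dsum mat_dsum_assoc)
  next
    fix z assume "z \<in> carrier (K0 X)"
    then obtain p q where z: "p \<in> Proj X" "q \<in> Proj X" "z = K0_diff X p q" by (rule carrier_K0E)
    then show "\<one>\<^bsub>K0 X\<^esub> \<otimes>\<^bsub>K0 X\<^esub> z = z" by (simp add: K0_mult o)
    show "\<exists>w\<in>carrier (K0 X). w \<otimes>\<^bsub>K0 X\<^esub> z = \<one>\<^bsub>K0 X\<^esub>"
      using z by (intro bexI[of _ "K0_diff X q p"]) (simp_all add: K0_mult o inv)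
  qed (simp add: o)
qed

section \<open>The rank of a projection at a point\<close>

text \<open>Kept polymorphic in the entries: the trace of a matrix over C(X) is itself a function on
  X, and its values are traces of complex matrices.\<close>

definition mat_trace :: "'b::comm_monoid_add mat \<Rightarrow> 'b" where
  "mat_trace A = (\<Sum>i<dim_row A. A $$ (i, i))"

text \<open>Rectangular factors are allowed because the matrices implementing an equivalence are
  rectangular.\<close>

lemma mat_trace_mult_commute:
  fixes A B :: "'b::comm_semiring_0 mat"
  assumes "dim_col A = dim_row B" "dim_col B = dim_row A"
  shows "mat_trace (A * B) = mat_trace (B * A)"
proof -
  have "mat_trace (A * B) = (\<Sum>i<dim_row A. \<Sum>k<dim_row B. A $$ (i, k) * B $$ (k, i))"
    using assms by (simp add: mat_trace_def scalar_prod_def lessThan_atLeast0)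
  also have "\<dots> = (\<Sum>k<dim_row B. \<Sum>i<dim_row A. B $$ (k, i) * A $$ (i, k))"
    by (subst sum.swap) (simp add: mult.commute)
  also have "\<dots> = mat_trace (B * A)"
    using assms by (simp add: mat_trace_def scalar_prod_def lessThan_atLeast0)
  finally show ?thesis .
qed

lemma mat_trace_dsum:
  assumes "dim_col A = dim_row A" "dim_col B = dim_row B"
  shows "mat_trace (mat_dsum A B) = mat_trace A + mat_trace B"
proof -
  let ?f = "\<lambda>i. mat_dsum A B $$ (i, i)"
  have "mat_trace (mat_dsum A B) = (\<Sum>i<dim_row A + dim_row B. ?f i)" by (simp add: mat_trace_def)
  also have "\<dots> = (\<Sum>i<dim_row A. ?f i) + (\<Sum>i=dim_row A..<dim_row A + dim_row B. ?f i)"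
    by (simp add: lessThan_atLeast0 sum.atLeastLessThan_concat)
  also have "(\<Sum>i=dim_row A..<dim_row A + dim_row B. ?f i) = (\<Sum>i<dim_row B. ?f (i + dim_row A))"
    using sum.shift_bounds_nat_ivl[of ?f 0 "dim_row A" "dim_row B"]
    by (simp add: lessThan_atLeast0 add.commute)
  also have "(\<Sum>i<dim_row A. ?f i) = mat_trace A"
    using assms by (simp add: mat_trace_def mat_dsum_def)
  also have "(\<Sum>i<dim_row B. ?f (i + dim_row A)) = mat_trace B"
    using assms by (simp add: mat_trace_def mat_dsum_def)
  finally show ?thesis .
qed

text \<open>By Schur decomposition P is similar to an upper triangular B. Then B is idempotent too,
  each diagonal entry b satisfies b * b = b and so is 0 or 1, and similarity preserves the
  trace.\<close>

lemma idempotent_mat_trace_Ints: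
  fixes P :: "complex mat"
  assumes P: "P \<in> carrier_mat n n" and idem: "P * P = P"
  shows "mat_trace P \<in> \<int>"
proof -
  obtain es where "char_poly P = (\<Prod>a\<leftarrow>es. [:- a, 1:])"
    using char_poly_factorized[OF P] by blast
  from schur_decomposition_exists[OF P this] obtain B where B: "B \<in> carrier_mat n n"
    and ut: "upper_triangular B" and "similar_mat P B" by blast
  then obtain S T where "similar_mat_wit P B S T" by (auto simp: similar_mat_def)
  from similar_mat_witD2[OF P this] have ST: "S \<in> carrier_mat n n" "T \<in> carrier_mat n n"
    "S * T = 1\<^sub>m n" "T * S = 1\<^sub>m n" "P = S * B * T" by auto
  have B_eq: "B = T * P * S"
  proof -
    have "T * P * S = (T * S) * B * (T * S)"
      using ST(1,2) B by (simp add: ST(5) mat_mult_assoc)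
    then show ?thesis using B by (simp add: ST(4))
  qed
  have "B * B = T * (P * ((S * T) * (P * S)))"
    using ST(1,2) P by (simp add: B_eq mat_mult_assoc)
  also have "\<dots> = T * ((P * P) * S)"
    using ST(1,2) P by (simp add: ST(3) mat_mult_assoc)
  also have "\<dots> = B" using ST(1,2) P by (simp add: idem B_eq mat_mult_assoc)
  finally have BB: "B * B = B" .
  have diag: "B $$ (i, i) \<in> \<int>" if i: "i < n" for i
  proof -
    have "B $$ (i, i) = (\<Sum>k\<in>{0..<n}. B $$ (i, k) * B $$ (k, i))"
      using i B arg_cong[OF BB, of "\<lambda>M. M $$ (i, i)"] by (simp add: scalar_prod_def)
    \<comment> \<open>For k different from i one of the two factors lies strictly below the
      diagonal.\<close>
    also have "\<dots> = (\<Sum>k\<in>{i}. B $$ (i, k) * B $$ (k, i))"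
    proof (rule sum.mono_neutral_right)
      show "\<forall>k\<in>{0..<n} - {i}. B $$ (i, k) * B $$ (k, i) = 0"
      proof
        fix k assume k: "k \<in> {0..<n} - {i}"
        then consider "k < i" | "i < k" by fastforce
        then show "B $$ (i, k) * B $$ (k, i) = 0"
          using upper_triangularD[OF ut, of k i] upper_triangularD[OF ut, of i k] i k B by cases auto
      qed
    qed (use i in auto)
    finally have "B $$ (i, i) * (B $$ (i, i) - 1) = 0" by (simp add: algebra_simps)
    then have "B $$ (i, i) = 0 \<or> B $$ (i, i) = 1" by simp
    then show ?thesis by auto
  qed
  have "mat_trace P = mat_trace (T * (S * B))"
    unfolding ST(5) by (rule mat_trace_mult_commute) (use ST(1,2) B in auto)
  also have "T * (S * B) = (T * S) * B"
    using ST(1,2) B by (simp add: mat_mult_assoc)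
  also have "\<dots> = B" using B by (simp add: ST(4))
  finally show ?thesis using diag B by (auto simp: mat_trace_def intro!: Ints_sum)
qed

lemma mat_trace_apply: "mat_trace A x = (\<Sum>i<dim_row A. (A $$ (i, i)) x)"
  by (simp add: mat_trace_def sum_fun_apply)

lemma Proj_trace_Ints:
  assumes "p \<in> Proj X"
  shows "mat_trace p x \<in> \<int>"
proof -
  note P = ProjD[OF assms]
  define Q where "Q = map_mat (\<lambda>f. f x) p"
  have Q: "Q \<in> carrier_mat (dim_row p) (dim_row p)" using P(3) by (auto simp: Q_def)
  have "Q * Q = map_mat (\<lambda>f. f x) (p * p)"
    by (rule eq_matI) (auto simp: Q_def P(3) scalar_prod_def sum_fun_apply)
  then have "Q * Q = Q" unfolding P(4) Q_def .
  from idempotent_mat_trace_Ints[OF Q this] show ?thesis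
    using P(3) by (simp add: sum_fun_apply mat_trace_def Q_def)
qed

text \<open>The rank of the complex projection p(x). \<open>Re\<close> and the floor only force the
  type \<open>int\<close>; on projections they lose nothing, by
  \<open>of_int_rank_at\<close>.\<close>

definition rank_at :: "('a \<Rightarrow> complex) mat \<Rightarrow> 'a \<Rightarrow> int" where
  "rank_at p x = \<lfloor>Re (mat_trace p x)\<rfloor>"

lemma of_int_rank_at: "p \<in> Proj X \<Longrightarrow> of_int (rank_at p x) = mat_trace p x"
  using Proj_trace_Ints[of p X x] by (auto simp: rank_at_def elim!: Ints_cases)

text \<open>Since p equals p times its adjoint, the trace is the squared Hilbert-Schmidt norm. This
  yields both that ranks are nonnegative and that rank 0 forces p(x) = 0.\<close>

lemma Proj_trace_eq_norms:
  assumes "p \<in> Proj X"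
  shows "mat_trace p x = of_real (\<Sum>i<dim_row p. \<Sum>k<dim_row p. (cmod ((p $$ (i, k)) x))\<^sup>2)"
proof -
  note P = ProjD[OF assms]
  have "mat_trace p x = mat_trace (p * star_mat p) x" by (simp only: P)
  also have "\<dots> = (\<Sum>i<dim_row p. \<Sum>k<dim_row p. (p $$ (i, k)) x * cnj ((p $$ (i, k)) x))"
    using P(3) by (simp add: mat_trace_apply mult_mat_index_apply del: index_mult_mat(1))
  also have "\<dots> = of_real (\<Sum>i<dim_row p. \<Sum>k<dim_row p. (cmod ((p $$ (i, k)) x))\<^sup>2)"
    by (simp add: complex_norm_square[symmetric])
  finally show ?thesis .
qed

lemma rank_at_nonneg: "p \<in> Proj X \<Longrightarrow> rank_at p x \<ge> 0"
  by (simp add: rank_at_def Proj_trace_eq_norms sum_nonneg)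

lemma rank_at_eq_zeroD:
  assumes "p \<in> Proj X" "rank_at p x = 0" "i < dim_row p" "k < dim_row p"
  shows "(p $$ (i, k)) x = 0"
proof -
  have "(\<Sum>i<dim_row p. \<Sum>k<dim_row p. (cmod ((p $$ (i, k)) x))\<^sup>2) = 0"
    using of_int_rank_at[OF assms(1), of x] Proj_trace_eq_norms[OF assms(1), of x] assms(2)
    by (metis of_int_0 of_real_eq_0_iff)
  then have "\<forall>i<dim_row p. \<forall>k<dim_row p. (cmod ((p $$ (i, k)) x))\<^sup>2 = 0"
    by (simp add: sum_nonneg_eq_0_iff sum_nonneg)
  then show ?thesis using assms by simp
qed

lemma rank_at_dsum:
  assumes "p \<in> Proj X" "q \<in> Proj X"
  shows "rank_at (mat_dsum p q) x = rank_at p x + rank_at q x"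
proof -
  have "(of_int (rank_at (mat_dsum p q) x) :: complex) = of_int (rank_at p x + rank_at q x)"
    using ProjD(3)[OF assms(1)] ProjD(3)[OF assms(2)] Proj_dsum[OF assms]
    by (simp add: of_int_rank_at[OF assms(1)] of_int_rank_at[OF assms(2)] of_int_rank_at mat_trace_dsum)
  then show ?thesis by (simp only: of_int_eq_iff)
qed

lemma rank_at_MvN:
  assumes "MvN_equiv X p q"
  shows "rank_at p = rank_at q"
proof -
  obtain v where v: "v \<in> CX_mat X (dim_row q) (dim_row p)" "star_mat v * v = p" "v * star_mat v = q"
    using assms by (auto simp: MvN_equiv_def)
  then have "mat_trace p = mat_trace q"
    using mat_trace_mult_commute[of "star_mat v" v] by simp
  then show ?thesis by (simp add: rank_at_def fun_eq_iff)
qed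

text \<open>Ranks take values in \<int>, where the auxiliary summand r does cancel, so the
  difference of ranks descends to K_0.\<close>

lemma rank_at_K0_rel:
  assumes "((p, q), (p', q')) \<in> K0_rel X"
  shows "rank_at p x - rank_at q x = rank_at p' x - rank_at q' x"
proof -
  obtain r where P: "p \<in> Proj X" "q \<in> Proj X" "p' \<in> Proj X" "q' \<in> Proj X" "r \<in> Proj X"
    and "MvN_equiv X (mat_dsum (mat_dsum p q') r) (mat_dsum (mat_dsum p' q) r)"
    using assms by (auto simp: K0_rel_def)
  from fun_cong[OF rank_at_MvN[OF this(6)], of x] show ?thesis
    using P by (simp add: rank_at_dsum[of _ X] Proj_dsum)
qed

definition K0_rank :: "'a topology \<Rightarrow> 'a \<Rightarrow> 'a K0_elem \<Rightarrow> int" where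
  "K0_rank X x z = (THE n. \<exists>p\<in>Proj X. \<exists>q\<in>Proj X. z = K0_diff X p q \<and> n = rank_at p x - rank_at q x)"

lemma K0_rank_diff:
  assumes "p \<in> Proj X" "q \<in> Proj X"
  shows "K0_rank X x (K0_diff X p q) = rank_at p x - rank_at q x"
  unfolding K0_rank_def
proof (rule the_equality)
  fix n assume "\<exists>p'\<in>Proj X. \<exists>q'\<in>Proj X. K0_diff X p q = K0_diff X p' q' \<and> n = rank_at p' x - rank_at q' x"
  then obtain p' q' where P: "p' \<in> Proj X" "q' \<in> Proj X" and eq: "K0_diff X p q = K0_diff X p' q'"
    and n: "n = rank_at p' x - rank_at q' x" by blast
  from eq have "((p, q), (p', q')) \<in> K0_rel X" unfolding K0_diff_eq_iff[OF assms P] .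
  from rank_at_K0_rel[OF this, of x] n show "n = rank_at p x - rank_at q x" by simp
qed (use assms in blast)

lemma rank_at_empty [simp]: "rank_at (0\<^sub>m 0 0) x = 0"
  by (simp add: rank_at_def mat_trace_def)

lemma K0_rank_class: "p \<in> Proj X \<Longrightarrow> K0_rank X x (K0_class X p) = rank_at p x"
  by (simp add: K0_class_def K0_rank_diff)

lemma K0_rank_mult:
  assumes "z \<in> carrier (K0 X)" "w \<in> carrier (K0 X)"
  shows "K0_rank X x (z \<otimes>\<^bsub>K0 X\<^esub> w) = K0_rank X x z + K0_rank X x w"
proof -
  obtain p q where z: "p \<in> Proj X" "q \<in> Proj X" "z = K0_diff X p q" by (rule carrier_K0E[OF assms(1)])
  obtain p' q' where w: "p' \<in> Proj X" "q' \<in> Proj X" "w = K0_diff X p' q'" by (rule carrier_K0E[OF assms(2)])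
  have "K0_rank X x (z \<otimes>\<^bsub>K0 X\<^esub> w) = rank_at (mat_dsum p p') x - rank_at (mat_dsum q q') x"
    unfolding z(3) w(3) K0_mult[OF z(1,2) w(1,2)]
    by (rule K0_rank_diff[OF Proj_dsum[OF z(1) w(1)] Proj_dsum[OF z(2) w(2)]])
  also have "\<dots> = K0_rank X x z + K0_rank X x w"
    unfolding z(3) w(3) K0_rank_diff[OF z(1,2)] K0_rank_diff[OF w(1,2)]
      rank_at_dsum[OF z(1) w(1)] rank_at_dsum[OF z(2) w(2)] by simp
  finally show ?thesis .
qed

text \<open>This is how the evaluations detect zero on the positive cone: vanishing rank makes every
  entry of p vanish, and a zero projection of any size is equivalent to the empty one.\<close>

lemma rank_at_zero_imp_class_one:
  assumes p: "p \<in> Proj X" and "\<And>x. x \<in> topspace X \<Longrightarrow> rank_at p x = 0"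
  shows "K0_class X p = \<one>\<^bsub>K0 X\<^esub>"
proof -
  note P = ProjD[OF p]
  have "p $$ (i, k) = 0" if "i < dim_row p" "k < dim_row p" for i k
  proof
    fix x
    have "p $$ (i, k) \<in> CX X" using P(1) that unfolding CX_mat_def by blast
    \<comment> \<open>Off the space the entry vanishes by the convention built into
      \<open>CX\<close>.\<close>
    then show "(p $$ (i, k)) x = 0 x"
      using rank_at_eq_zeroD[OF p assms(2)] that by (cases "x \<in> topspace X") (auto simp: CX_def)
  qed
  then have p0: "p = 0\<^sub>m (dim_row p) (dim_row p)"
    using P(3) by (intro eq_matI) auto
  \<comment> \<open>A matrix without rows implements the equivalence between the zero projection and
    the empty matrix.\<close>
  let ?v = "0\<^sub>m 0 (dim_row p) :: ('a \<Rightarrow> complex) mat"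
  have "star_mat ?v * ?v = 0\<^sub>m (dim_row p) (dim_row p)" "?v * star_mat ?v = 0\<^sub>m 0 0"
    by (auto intro!: eq_matI)
  then have "star_mat ?v * ?v = p" "?v * star_mat ?v = 0\<^sub>m 0 0"
    unfolding p0[symmetric] .
  moreover have "?v \<in> CX_mat X (dim_row (0\<^sub>m 0 0 :: ('a \<Rightarrow> complex) mat)) (dim_row p)" by simp
  ultimately have "MvN_equiv X p (0\<^sub>m 0 0)"
    unfolding MvN_equiv_def by blast
  then have "MvN_class X p = MvN_class X (0\<^sub>m 0 0)" using p by (simp add: MvN_class_eq_iff)
  then have "K0_diff X p (0\<^sub>m 0 0) = K0_diff X (0\<^sub>m 0 0) (0\<^sub>m 0 0)"
    using p by (intro K0_diff_eqI) auto
  then show ?thesis by (simp add: K0_class_def K0_def)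
qed

lemma continuous_map_mat_trace:
  assumes "p \<in> Proj X"
  shows "continuous_map X euclidean (mat_trace p)"
proof -
  have "p $$ (i, i) \<in> CX X" if "i < dim_row p" for i
    using ProjD(1)[OF assms] that unfolding CX_mat_def by blast
  then have "mat_trace p \<in> CX X"
    unfolding mat_trace_def by (intro CX_sum) simp
  then show ?thesis by (simp add: CX_def)
qed

section \<open>Order automorphisms of \<open>\<int>\<^sup>d\<close>\<close>

lemma Z_pow_simps [simp]:
  "carrier (Z_pow d) = ({..<d} \<rightarrow>\<^sub>E UNIV)"
  "x \<otimes>\<^bsub>Z_pow d\<^esub> y = (\<lambda>i\<in>{..<d}. x i + y i)"
  "\<one>\<^bsub>Z_pow d\<^esub> = (\<lambda>i\<in>{..<d}. 0)"
  "pcone (Z_pow d) = ({..<d} \<rightarrow>\<^sub>E {0..})"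
  "ounit (Z_pow d) = (\<lambda>i\<in>{..<d}. 1)"
  by (simp_all add: Z_pow_def monoid.defs product_group_def integer_group_def)

lemma OAut_simps:
  "carrier (OAut G) = {\<tau> \<in> auto G. \<tau> ` pcone G = pcone G \<and> \<tau> (ounit G) = ounit G}"
  "\<tau> \<in> carrier (OAut G) \<Longrightarrow> \<tau>' \<in> carrier (OAut G) \<Longrightarrow>
    \<tau> \<otimes>\<^bsub>OAut G\<^esub> \<tau>' = compose (carrier G) \<tau> \<tau>'"
  by (auto simp: OAut_def AutoGroup_def BijGroup_def auto_def)

definition Z_basis :: "nat \<Rightarrow> nat \<Rightarrow> nat \<Rightarrow> int" where
  "Z_basis d i = (\<lambda>k\<in>{..<d}. if k = i then 1 else 0)"

lemma Z_basis_pcone: "Z_basis d i \<in> pcone (Z_pow d)"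
  by (auto simp: Z_basis_def)

lemma Z_basis_inject: "i < d \<Longrightarrow> Z_basis d i = Z_basis d j \<longleftrightarrow> i = j"
  by (auto simp: Z_basis_def fun_eq_iff restrict_def split: if_splits)

section \<open>From order automorphisms of \<int>^d to permutations of the coordinates\<close>

lemma OAut_Z_powD:
  assumes "\<tau> \<in> carrier (OAut (Z_pow d))"
  shows "\<And>x y. x \<in> {..<d} \<rightarrow>\<^sub>E UNIV \<Longrightarrow> y \<in> {..<d} \<rightarrow>\<^sub>E UNIV \<Longrightarrow>
      \<tau> (\<lambda>i\<in>{..<d}. x i + y i) = (\<lambda>i\<in>{..<d}. \<tau> x i + \<tau> y i)"
    and "\<And>x. x \<in> {..<d} \<rightarrow>\<^sub>E {0..} \<Longrightarrow> \<tau> x \<in> {..<d} \<rightarrow>\<^sub>E {0..}"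
    and "\<And>x. x \<in> {..<d} \<rightarrow>\<^sub>E UNIV \<Longrightarrow> \<tau> x \<in> {..<d} \<rightarrow>\<^sub>E UNIV"
    and "inj_on \<tau> ({..<d} \<rightarrow>\<^sub>E UNIV)"
    and "\<tau> (\<lambda>i\<in>{..<d}. 1) = (\<lambda>i\<in>{..<d}. 1)"
    and "\<tau> (\<lambda>i\<in>{..<d}. 0) = (\<lambda>i\<in>{..<d}. 0)"
proof -
  have h: "\<tau> \<in> hom (Z_pow d) (Z_pow d)" and b: "bij_betw \<tau> ({..<d} \<rightarrow>\<^sub>E UNIV) ({..<d} \<rightarrow>\<^sub>E UNIV)"
    and p: "\<tau> ` ({..<d} \<rightarrow>\<^sub>E {0..}) = {..<d} \<rightarrow>\<^sub>E {0..}"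
    and u: "\<tau> (\<lambda>i\<in>{..<d}. 1) = (\<lambda>i\<in>{..<d}. 1)"
    using assms by (auto simp: OAut_simps auto_def Bij_def)
  show add: "\<tau> (\<lambda>i\<in>{..<d}. x i + y i) = (\<lambda>i\<in>{..<d}. \<tau> x i + \<tau> y i)"
    if "x \<in> {..<d} \<rightarrow>\<^sub>E UNIV" "y \<in> {..<d} \<rightarrow>\<^sub>E UNIV" for x y
    using hom_mult[OF h, of x y] that by simp
  show "\<tau> x \<in> {..<d} \<rightarrow>\<^sub>E {0..}" if "x \<in> {..<d} \<rightarrow>\<^sub>E {0..}" for x
    using that p by blast
  show cl: "\<tau> x \<in> {..<d} \<rightarrow>\<^sub>E UNIV" if "x \<in> {..<d} \<rightarrow>\<^sub>E UNIV" for x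
    using that hom_in_carrier[OF h, of x] by simp
  show "inj_on \<tau> ({..<d} \<rightarrow>\<^sub>E UNIV)" using b by (simp add: bij_betw_def)
  show "\<tau> (\<lambda>i\<in>{..<d}. 1) = (\<lambda>i\<in>{..<d}. 1)" by (fact u)
  let ?z = "\<lambda>i\<in>{..<d}. 0::int"
  have zc: "?z \<in> {..<d} \<rightarrow>\<^sub>E UNIV" by auto
  have "\<tau> (\<lambda>i\<in>{..<d}. ?z i + ?z i) = (\<lambda>i\<in>{..<d}. \<tau> ?z i + \<tau> ?z i)"
    by (rule add[OF zc zc])
  moreover have "(\<lambda>i\<in>{..<d}. ?z i + ?z i) = ?z" by (auto simp: fun_eq_iff)
  \<comment> \<open>Inside \<open>{..<d}\<close> this reads a = a + a, hence a = 0; outside, both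
    sides are \<open>undefined\<close>.\<close>
  ultimately have *: "\<tau> ?z = (\<lambda>i\<in>{..<d}. \<tau> ?z i + \<tau> ?z i)" by simp
  show "\<tau> ?z = ?z"
  proof
    fix i
    show "\<tau> ?z i = ?z i"
    proof (cases "i < d")
      case True
      then show ?thesis using fun_cong[OF *, of i] by simp
    next
      case False
      then show ?thesis using fun_cong[OF *, of i] by simp
    qed
  qed
qed

text \<open>The images of the basis vectors are nonzero, nonnegative and add up to \<open>(1,\<dots>,1)\<close>, so
  there is no room for anything but a permutation.\<close>

lemma OAut_Z_pow_basis:
  assumes \<tau>: "\<tau> \<in> carrier (OAut (Z_pow d))" and "i < d"
  shows "\<exists>j<d. \<tau> (Z_basis d i) = Z_basis d j"
proof -
  note D = OAut_Z_powD[OF \<tau>]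
  let ?T = "\<lambda>i. \<tau> (Z_basis d i)"
  have bc: "Z_basis d i \<in> {..<d} \<rightarrow>\<^sub>E UNIV" for i by (auto simp: Z_basis_def)
  have T: "?T i \<in> {..<d} \<rightarrow>\<^sub>E {0..}" for i
    by (rule D(2)) (use Z_basis_pcone in simp)
  then have T0: "k < d \<Longrightarrow> ?T i k \<ge> 0" for i k
    by (auto dest: PiE_mem)
  \<comment> \<open>\<tau> is known to be additive for two summands only, so the images of the first
    m basis vectors are added up by induction. At m = d the argument is the order unit, which \<tau>
    fixes.\<close>
  have partial: "k < d \<Longrightarrow> \<tau> (\<lambda>k\<in>{..<d}. if k < m then 1 else 0) k = (\<Sum>i<m. ?T i k)" if "m \<le> d" for m k
    using that
  proof (induction m)
    case 0
    then show ?case using D(6) by (simp add: restrict_def)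
  next
    case (Suc m)
    let ?P = "\<lambda>k\<in>{..<d}. if k < m then 1 else (0::int)"
    have "(\<lambda>k\<in>{..<d}. if k < Suc m then 1 else (0::int)) = (\<lambda>k\<in>{..<d}. ?P k + Z_basis d m k)"
      by (auto simp: fun_eq_iff Z_basis_def)
    moreover have "?P \<in> {..<d} \<rightarrow>\<^sub>E UNIV" by auto
    ultimately have "\<tau> (\<lambda>k\<in>{..<d}. if k < Suc m then 1 else 0) = (\<lambda>i\<in>{..<d}. \<tau> ?P i + ?T m i)"
      using D(1)[OF _ bc] by (simp only:)
    then show ?case using Suc by (simp add: restrict_def)
  qed
  have sum1: "(\<Sum>i<d. ?T i k) = 1" if "k < d" for k
  proof -
    have "(\<lambda>k\<in>{..<d}. if k < d then 1 else (0::int)) = (\<lambda>k\<in>{..<d}. 1)" by (auto simp: fun_eq_iff)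
    then show ?thesis using partial[of d k] D(5) that by simp
  qed
  \<comment> \<open>Otherwise \<tau> would send a basis vector and 0 to the same place, against
    injectivity.\<close>
  have "\<exists>k<d. ?T i k \<ge> 1" if "i < d" for i
  proof (rule ccontr)
    assume "\<not> ?thesis"
    then have "k < d \<Longrightarrow> ?T i k = 0" for k using T0[of k i] by force
    then have "?T i = (\<lambda>i\<in>{..<d}. 0)"
      using T[of i] by (auto simp: fun_eq_iff PiE_iff extensional_def)
    then have "?T i = \<tau> (\<lambda>i\<in>{..<d}. 0)" by (simp add: D(6))
    then have "Z_basis d i = (\<lambda>i\<in>{..<d}. 0)"
      by (rule inj_onD[OF D(4)]) (auto simp: Z_basis_def)
    from fun_cong[OF this, of i] show False using that by (simp add: Z_basis_def)
  qed
  then obtain f where f: "\<And>i. i < d \<Longrightarrow> f i < d \<and> ?T i (f i) \<ge> 1" by metis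
  \<comment> \<open>At each coordinate k the images contribute nonnegative integers with sum 1, so
    at most one of them is nonzero there.\<close>
  have zero: "?T i k = 0" if "i < d" "i' < d" "i \<noteq> i'" "k < d" "?T i' k \<ge> 1" for i i' k
  proof -
    have "?T i k + ?T i' k = (\<Sum>j\<in>{i, i'}. ?T j k)" using that by simp
    also have "\<dots> \<le> (\<Sum>j<d. ?T j k)" using that T0 by (intro sum_mono2) auto
    finally show ?thesis using sum1[of k] T0[of k i] that by simp
  qed
  have "inj_on f {..<d}"
    using zero f by (intro inj_onI) (metis lessThan_iff not_one_le_zero)
  moreover have "f ` {..<d} \<subseteq> {..<d}" using f by auto
  \<comment> \<open>Surjectivity of f is what makes \<open>?T i\<close> vanish away from
    \<open>f i\<close>: every other coordinate is already claimed by another basis vector.\<close>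
  ultimately have surj: "f ` {..<d} = {..<d}" by (meson endo_inj_surj finite_lessThan)
  have "?T i k = Z_basis d (f i) k" for k
  proof (cases "k < d")
    case True
    then obtain i' where i': "i' < d" "k = f i'" using surj by auto
    show ?thesis
    proof (cases "i' = i")
      case True
      have "?T i (f i) \<le> (\<Sum>j<d. ?T j (f i))"
        using f \<open>i < d\<close> T0 by (intro member_le_sum) auto
      then show ?thesis using sum1[of "f i"] f[OF \<open>i < d\<close>] i' True by (simp add: Z_basis_def)
    next
      case False
      then have "?T i k = 0" using zero[of i i' k] f i' \<open>i < d\<close> by auto
      moreover have "k \<noteq> f i"
        using \<open>inj_on f {..<d}\<close> False i' \<open>i < d\<close> by (auto dest: inj_onD)
      ultimately show ?thesis using \<open>k < d\<close> by (simp add: Z_basis_def)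
    qed
  next
    case False
    then show ?thesis using T[of i] by (auto simp: Z_basis_def PiE_iff extensional_def)
  qed
  then show ?thesis using f[OF \<open>i < d\<close>] by blast
qed

text \<open>Distinct indices have distinct basis vectors, so the index j chosen by
  \<open>SOME\<close> is unique and the composition law of \<sigma> passes to the indices. The
  restriction to \<open>{..<d}\<close> is what \<open>Bij\<close> demands.\<close>

lemma OAut_hom_imp_action:
  assumes "group \<Gamma>" and \<sigma>: "\<sigma> \<in> hom \<Gamma> (OAut (Z_pow d))"
  obtains \<theta> where "group_action \<Gamma> {..<d} \<theta>"
    and "\<And>t i. t \<in> carrier \<Gamma> \<Longrightarrow> i < d \<Longrightarrow> \<theta> t i < d \<and> \<sigma> t (Z_basis d i) = Z_basis d (\<theta> t i)"
proof -
  interpret \<Gamma>: group \<Gamma> by fact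
  define \<theta> where "\<theta> t = (\<lambda>i\<in>{..<d}. SOME j. j < d \<and> \<sigma> t (Z_basis d i) = Z_basis d j)" for t
  have OA: "\<sigma> t \<in> carrier (OAut (Z_pow d))" if "t \<in> carrier \<Gamma>" for t
    using hom_in_carrier[OF \<sigma> that] .
  have \<theta>: "\<theta> t i < d \<and> \<sigma> t (Z_basis d i) = Z_basis d (\<theta> t i)" if "t \<in> carrier \<Gamma>" "i < d" for t i
    using someI_ex[OF OAut_Z_pow_basis[OF OA[OF that(1)] that(2)]] that(2) by (simp add: \<theta>_def)
  have bc: "Z_basis d i \<in> {..<d} \<rightarrow>\<^sub>E UNIV" for i by (auto simp: Z_basis_def)
  have Bij: "\<theta> t \<in> Bij {..<d}" if t: "t \<in> carrier \<Gamma>" for t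
  proof -
    have "inj_on (\<theta> t) {..<d}"
    proof (rule inj_onI)
      fix i j assume ij: "i \<in> {..<d}" "j \<in> {..<d}" "\<theta> t i = \<theta> t j"
      then have "\<sigma> t (Z_basis d i) = \<sigma> t (Z_basis d j)" using \<theta>[OF t] by simp
      then have "Z_basis d i = Z_basis d j" by (rule inj_onD[OF OAut_Z_powD(4)[OF OA[OF t]]]) (rule bc)+
      then show "i = j" using ij Z_basis_inject by simp
    qed
    moreover have "\<theta> t ` {..<d} \<subseteq> {..<d}" using \<theta>[OF t] by auto
    ultimately have "bij_betw (\<theta> t) {..<d} {..<d}"
      by (simp add: bij_betw_def endo_inj_surj)
    then show ?thesis by (simp add: Bij_def \<theta>_def)
  qed
  have comp: "\<theta> (s \<otimes>\<^bsub>\<Gamma>\<^esub> t) = compose {..<d} (\<theta> s) (\<theta> t)" if st: "s \<in> carrier \<Gamma>" "t \<in> carrier \<Gamma>" for s t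
  proof
    fix i
    show "\<theta> (s \<otimes>\<^bsub>\<Gamma>\<^esub> t) i = compose {..<d} (\<theta> s) (\<theta> t) i"
    proof (cases "i < d")
      case True
      have "\<sigma> (s \<otimes>\<^bsub>\<Gamma>\<^esub> t) = compose ({..<d} \<rightarrow>\<^sub>E UNIV) (\<sigma> s) (\<sigma> t)"
        using hom_mult[OF \<sigma> st] OA st by (simp add: OAut_simps(2))
      then have "\<sigma> (s \<otimes>\<^bsub>\<Gamma>\<^esub> t) (Z_basis d i) = \<sigma> s (\<sigma> t (Z_basis d i))"
        using bc by (simp add: compose_def)
      then have "Z_basis d (\<theta> (s \<otimes>\<^bsub>\<Gamma>\<^esub> t) i) = Z_basis d (\<theta> s (\<theta> t i))"
        using \<theta> st True \<Gamma>.m_closed by metis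
      then show ?thesis using True \<theta> st Z_basis_inject \<Gamma>.m_closed by (simp add: compose_def)
    next
      case False
      then show ?thesis by (simp add: \<theta>_def compose_def)
    qed
  qed
  have "group_hom \<Gamma> (BijGroup {..<d}) \<theta>"
    by (intro group_hom.intro group_hom_axioms.intro group_BijGroup homI)
      (simp_all add: BijGroup_def Bij comp \<Gamma>.is_group)
  then have "group_action \<Gamma> {..<d} \<theta>" by (rule group_action.intro)
  then show thesis using \<theta> that by blast
qed

text \<open>The difference of v and the i-th basis vector is still positive, hence so is its image.
  Thus the support of a positive vector moves along the permutation given by \<tau>.\<close>

lemma OAut_basis_le:
  assumes \<tau>: "\<tau> \<in> carrier (OAut (Z_pow d))" and "v \<in> pcone (Z_pow d)" "i < d" "v i \<ge> 1" "j < d"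
    and "\<tau> (Z_basis d i) = Z_basis d j"
  shows "\<tau> v j \<ge> 1"
proof -
  note D = OAut_Z_powD[OF \<tau>]
  define w where "w = (\<lambda>k\<in>{..<d}. v k - Z_basis d i k)"
  have w: "w \<in> {..<d} \<rightarrow>\<^sub>E {0..}"
    using assms by (auto simp: w_def Z_basis_def PiE_iff)
  then have wc: "w \<in> {..<d} \<rightarrow>\<^sub>E UNIV" by (auto simp: PiE_iff)
  have "v = (\<lambda>k\<in>{..<d}. Z_basis d i k + w k)"
    using assms(2) by (auto simp: w_def fun_eq_iff PiE_iff extensional_def)
  then have "\<tau> v = (\<lambda>k\<in>{..<d}. Z_basis d j k + \<tau> w k)"
    using D(1)[OF _ wc, of "Z_basis d i"] assms(6) by (auto simp: Z_basis_def)
  moreover have "\<tau> w j \<ge> 0" using D(2)[OF w] \<open>j < d\<close> by (auto dest: PiE_mem)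
  ultimately show ?thesis using \<open>j < d\<close> by (simp add: Z_basis_def)
qed

section \<open>From permutations of the coordinates to order automorphisms of \<int>^d\<close>

definition Z_perm :: "nat \<Rightarrow> (nat \<Rightarrow> nat) \<Rightarrow> (nat \<Rightarrow> int) \<Rightarrow> nat \<Rightarrow> int" where
  "Z_perm d \<pi> = (\<lambda>v\<in>carrier (Z_pow d). \<lambda>i\<in>{..<d}. v (\<pi> i))"

text \<open>Reading coordinates through a permutation reverses the order of composition. The inverse
  of t in \<open>action_imp_OAut_hom\<close> compensates for this.\<close>

lemma Z_perm_comp:
  assumes "\<pi> ` {..<d} \<subseteq> {..<d}" "v \<in> carrier (Z_pow d)"
  shows "Z_perm d \<pi> (Z_perm d \<pi>' v) = Z_perm d (\<pi>' \<circ> \<pi>) v"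
  using assms by (auto simp: Z_perm_def fun_eq_iff image_subset_iff)

lemma Z_perm_OAut:
  assumes "bij_betw \<pi> {..<d} {..<d}"
  shows "Z_perm d \<pi> \<in> carrier (OAut (Z_pow d))"
proof -
  let ?\<pi>' = "inv_into {..<d} \<pi>"
  have \<pi>: "\<And>i. i < d \<Longrightarrow> \<pi> i < d" "\<And>i. i < d \<Longrightarrow> ?\<pi>' i < d"
    "\<And>i. i < d \<Longrightarrow> \<pi> (?\<pi>' i) = i" "\<And>i. i < d \<Longrightarrow> ?\<pi>' (\<pi> i) = i"
    using assms bij_betwE[OF assms] bij_betwE[OF bij_betw_inv_into[OF assms]]
    by (auto simp: bij_betw_inv_into_left bij_betw_inv_into_right)
  have id: "Z_perm d (\<pi> \<circ> ?\<pi>') v = v" "Z_perm d (?\<pi>' \<circ> \<pi>) v = v" if "v \<in> carrier (Z_pow d)" for v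
    using that \<pi> by (auto simp: Z_perm_def fun_eq_iff PiE_iff extensional_def)
  have inv: "Z_perm d \<pi> (Z_perm d ?\<pi>' v) = v" "Z_perm d ?\<pi>' (Z_perm d \<pi> v) = v"
    if "v \<in> carrier (Z_pow d)" for v
    using that id \<pi> by (auto simp: Z_perm_comp image_subset_iff simp del: Z_pow_simps)
  have cl: "Z_perm d \<rho> v \<in> carrier (Z_pow d)" if "v \<in> carrier (Z_pow d)" for \<rho> v
    using that by (auto simp: Z_perm_def)
  have bij: "bij_betw (Z_perm d \<pi>) (carrier (Z_pow d)) (carrier (Z_pow d))"
    by (rule bij_betw_byWitness[where f' = "Z_perm d ?\<pi>'"]) (use inv cl in \<open>auto simp del: Z_pow_simps\<close>)
  have hom: "Z_perm d \<pi> \<in> hom (Z_pow d) (Z_pow d)"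
    using \<pi> by (auto simp: hom_def Z_perm_def fun_eq_iff)
  have pc: "Z_perm d \<rho> v \<in> pcone (Z_pow d)" if "v \<in> pcone (Z_pow d)" "\<And>i. i < d \<Longrightarrow> \<rho> i < d" for \<rho> v
  proof -
    have "v \<in> carrier (Z_pow d)" using that(1) by (auto simp: PiE_iff)
    then show ?thesis using that by (auto simp: Z_perm_def PiE_iff)
  qed
  have "Z_perm d \<pi> ` pcone (Z_pow d) = pcone (Z_pow d)"
  proof
    show "Z_perm d \<pi> ` pcone (Z_pow d) \<subseteq> pcone (Z_pow d)" using pc \<pi> by blast
    \<comment> \<open>\<open>OAut\<close> demands that the cone be mapped onto itself; permuting v
      by the inverse permutation gives a positive preimage.\<close>
    show "pcone (Z_pow d) \<subseteq> Z_perm d \<pi> ` pcone (Z_pow d)"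
    proof
      fix v assume v: "v \<in> pcone (Z_pow d)"
      then have "v \<in> carrier (Z_pow d)" by (auto simp: PiE_iff)
      then show "v \<in> Z_perm d \<pi> ` pcone (Z_pow d)"
        using inv(1)[of v] pc[OF v, of ?\<pi>'] \<pi> by (metis imageI)
    qed
  qed
  moreover have "Z_perm d \<pi> (ounit (Z_pow d)) = ounit (Z_pow d)"
    using \<pi> by (auto simp: Z_perm_def fun_eq_iff)
  moreover have "Z_perm d \<pi> \<in> extensional (carrier (Z_pow d))" by (simp add: Z_perm_def)
  ultimately show ?thesis
    using bij hom by (simp add: OAut_simps auto_def Bij_def del: Z_pow_simps)
qed

lemma action_imp_OAut_hom:
  assumes "group_action \<Gamma> {..<d} \<theta>"
  shows "(\<lambda>t. Z_perm d (\<theta> (inv\<^bsub>\<Gamma>\<^esub> t))) \<in> hom \<Gamma> (OAut (Z_pow d))"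
proof -
  interpret group_action \<Gamma> "{..<d}" \<theta> by fact
  interpret \<Gamma>: group \<Gamma> using group_hom by (rule group_hom.axioms(1))
  have b: "bij_betw (\<theta> (inv\<^bsub>\<Gamma>\<^esub> t)) {..<d} {..<d}" if "t \<in> carrier \<Gamma>" for t
    using bij_prop0[of "inv\<^bsub>\<Gamma>\<^esub> t"] that by (simp add: Bij_def)
  show ?thesis
  proof (rule homI)
    fix s t assume st: "s \<in> carrier \<Gamma>" "t \<in> carrier \<Gamma>"
    have "Z_perm d (\<theta> (inv\<^bsub>\<Gamma>\<^esub> (s \<otimes>\<^bsub>\<Gamma>\<^esub> t))) v = compose (carrier (Z_pow d)) (Z_perm d (\<theta> (inv\<^bsub>\<Gamma>\<^esub> s))) (Z_perm d (\<theta> (inv\<^bsub>\<Gamma>\<^esub> t))) v" for v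
    proof (cases "v \<in> carrier (Z_pow d)")
      case True
      have "compose (carrier (Z_pow d)) (Z_perm d (\<theta> (inv\<^bsub>\<Gamma>\<^esub> s))) (Z_perm d (\<theta> (inv\<^bsub>\<Gamma>\<^esub> t))) v =
          Z_perm d (\<theta> (inv\<^bsub>\<Gamma>\<^esub> t) \<circ> \<theta> (inv\<^bsub>\<Gamma>\<^esub> s)) v"
        using Z_perm_comp[OF _ True, of "\<theta> (inv\<^bsub>\<Gamma>\<^esub> s)"] bij_betw_imp_surj_on[OF b[OF st(1)]] True
        by (simp add: compose_def del: Z_pow_simps)
      also have "\<dots> = Z_perm d (\<theta> (inv\<^bsub>\<Gamma>\<^esub> (s \<otimes>\<^bsub>\<Gamma>\<^esub> t))) v"
        using st True by (auto simp: Z_perm_def \<Gamma>.inv_mult_group composition_rule fun_eq_iff)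
      finally show ?thesis by simp
    qed (simp add: Z_perm_def compose_def)
    then show "Z_perm d (\<theta> (inv\<^bsub>\<Gamma>\<^esub> (s \<otimes>\<^bsub>\<Gamma>\<^esub> t))) =
        Z_perm d (\<theta> (inv\<^bsub>\<Gamma>\<^esub> s)) \<otimes>\<^bsub>OAut (Z_pow d)\<^esub> Z_perm d (\<theta> (inv\<^bsub>\<Gamma>\<^esub> t))"
      using st by (simp add: OAut_simps(2) Z_perm_OAut b fun_eq_iff del: Z_pow_simps)
  qed (simp add: Z_perm_OAut b)
qed

section \<open>Induced maps on \<open>K\<^sub>0\<close>\<close>

text \<open>Composition with a self-map k, cut off outside the space to stay within the convention
  of \<open>CX\<close>. The induced action is the case where k is the action of the inverse; the
  maps induced on K_0 can then be studied for any continuous k.\<close>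

definition pullback :: "'a topology \<Rightarrow> ('a \<Rightarrow> 'a) \<Rightarrow> ('a \<Rightarrow> complex) \<Rightarrow> 'a \<Rightarrow> complex" where
  "pullback X k f = (\<lambda>x. if x \<in> topspace X then f (k x) else 0)"

lemma CX_action_eq_pullback: "CX_action \<Gamma> X h s = pullback X (h (inv\<^bsub>\<Gamma>\<^esub> s))"
  by (simp add: CX_action_def pullback_def fun_eq_iff)

lemma pullback_CX:
  assumes "continuous_map X X k" "f \<in> CX X"
  shows "pullback X k f \<in> CX X"
proof -
  have "continuous_map X euclidean (f \<circ> k)"
    by (rule continuous_map_compose[OF assms(1)]) (use assms(2) in \<open>auto simp: CX_def\<close>)
  then have "continuous_map X euclidean (pullback X k f)"
    by (rule continuous_map_eq) (auto simp: pullback_def)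
  then show ?thesis by (auto simp: CX_def pullback_def)
qed

lemma map_mat_pullback_mult:
  assumes "dim_col A = dim_row B"
  shows "map_mat (pullback X k) (A * B) = map_mat (pullback X k) A * map_mat (pullback X k) B"
proof (rule eq_matI)
  fix i j
  assume "i < dim_row (map_mat (pullback X k) A * map_mat (pullback X k) B)"
    "j < dim_col (map_mat (pullback X k) A * map_mat (pullback X k) B)"
  then have ij: "i < dim_row A" "j < dim_col B" by auto
  show "map_mat (pullback X k) (A * B) $$ (i, j) = (map_mat (pullback X k) A * map_mat (pullback X k) B) $$ (i, j)"
  proof
    fix x
    have "((map_mat (pullback X k) A * map_mat (pullback X k) B) $$ (i, j)) x =
       (\<Sum>l<dim_row B. pullback X k (A $$ (i, l)) x * pullback X k (B $$ (l, j)) x)"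
      using ij assms by (subst mult_mat_index_apply) auto
    also have "\<dots> = pullback X k ((A * B) $$ (i, j)) x"
      using mult_mat_index_apply[OF ij assms] by (simp add: pullback_def)
    finally show "(map_mat (pullback X k) (A * B) $$ (i, j)) x =
      ((map_mat (pullback X k) A * map_mat (pullback X k) B) $$ (i, j)) x"
      using ij by simp
  qed
qed auto

lemma map_mat_pullback_star: "map_mat (pullback X k) (star_mat A) = star_mat (map_mat (pullback X k) A)"
  by (rule eq_matI) (auto simp: pullback_def)

lemma map_mat_pullback_dsum:
  "map_mat (pullback X k) (mat_dsum A B) = mat_dsum (map_mat (pullback X k) A) (map_mat (pullback X k) B)"
proof -
  have "pullback X k 0 = 0" by (simp add: pullback_def fun_eq_iff)
  then show ?thesis by (intro eq_matI) (auto simp: mat_dsum_def)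
qed

lemma map_mat_pullback_CX_mat:
  assumes "continuous_map X X k" "A \<in> CX_mat X m n"
  shows "map_mat (pullback X k) A \<in> CX_mat X m n"
  using assms(2) pullback_CX[OF assms(1)] by (auto simp: CX_mat_def)

lemma map_mat_pullback_Proj:
  assumes "continuous_map X X k" "p \<in> Proj X"
  shows "map_mat (pullback X k) p \<in> Proj X"
proof -
  note P = ProjD[OF assms(2)]
  have "map_mat (pullback X k) p * map_mat (pullback X k) p = map_mat (pullback X k) p"
    using map_mat_pullback_mult[OF P(3)] by (simp only: P(4))
  moreover have "star_mat (map_mat (pullback X k) p) = map_mat (pullback X k) p"
    by (simp only: map_mat_pullback_star[symmetric] P(5))
  ultimately show ?thesis
    using map_mat_pullback_CX_mat[OF assms(1) P(1)] unfolding Proj_def by blast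
qed

text \<open>Entrywise pullback respects products and adjoints, so it carries an implementing matrix
  to an implementing matrix.\<close>

lemma MvN_equiv_pullback:
  assumes "continuous_map X X k" "MvN_equiv X p q"
  shows "MvN_equiv X (map_mat (pullback X k) p) (map_mat (pullback X k) q)"
proof -
  obtain v where v: "v \<in> CX_mat X (dim_row q) (dim_row p)" "star_mat v * v = p" "v * star_mat v = q"
    using assms(2) by (auto simp: MvN_equiv_def)
  let ?v = "map_mat (pullback X k) v"
  have "star_mat ?v * ?v = map_mat (pullback X k) p" "?v * star_mat ?v = map_mat (pullback X k) q"
    using map_mat_pullback_mult[of "star_mat v" v X k] map_mat_pullback_mult[of v "star_mat v" X k]
    by (simp_all add: v(2,3) map_mat_pullback_star)
  moreover have "?v \<in> CX_mat X (dim_row (map_mat (pullback X k) q)) (dim_row (map_mat (pullback X k) p))"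
    using map_mat_pullback_CX_mat[OF assms(1) v(1)] by simp
  ultimately show ?thesis unfolding MvN_equiv_def by blast
qed

lemma K0_rel_pullback:
  assumes k: "continuous_map X X k" and "((p, q), (p', q')) \<in> K0_rel X"
  shows "((map_mat (pullback X k) p, map_mat (pullback X k) q),
    (map_mat (pullback X k) p', map_mat (pullback X k) q')) \<in> K0_rel X"
proof -
  obtain r where P: "p \<in> Proj X" "q \<in> Proj X" "p' \<in> Proj X" "q' \<in> Proj X" "r \<in> Proj X"
    and "MvN_equiv X (mat_dsum (mat_dsum p q') r) (mat_dsum (mat_dsum p' q) r)"
    using assms(2) by (auto simp: K0_rel_def)
  from MvN_equiv_pullback[OF k this(6)] P show ?thesis
    unfolding K0_rel_def map_mat_pullback_dsum
    by (blast intro: map_mat_pullback_Proj[OF k])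
qed

lemma K0_map_pullback:
  assumes k: "continuous_map X X k" and "p \<in> Proj X" "q \<in> Proj X"
  shows "K0_map X (pullback X k) (K0_diff X p q) =
    K0_diff X (map_mat (pullback X k) p) (map_mat (pullback X k) q)"
  unfolding K0_map_def
proof (rule UN_K0_diff[OF assms(2,3)])
  fix p' q' assume "((p, q), (p', q')) \<in> K0_rel X"
  from K0_rel_pullback[OF k this]
  show "K0_diff X (map_mat (pullback X k) p') (map_mat (pullback X k) q') =
      K0_diff X (map_mat (pullback X k) p) (map_mat (pullback X k) q)"
    unfolding K0_diff_def by (rule equiv_class_eq[OF equiv_K0_rel, symmetric])
qed

lemma K0_map_pullback_class:
  assumes "continuous_map X X k" "p \<in> Proj X"
  shows "K0_map X (pullback X k) (K0_class X p) = K0_class X (map_mat (pullback X k) p)"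
proof -
  have "map_mat (pullback X k) (0\<^sub>m 0 0) = 0\<^sub>m 0 0" by (rule eq_matI) auto
  then show ?thesis using assms by (simp add: K0_class_def K0_map_pullback)
qed

text \<open>Through this, acting on a class in K_0 amounts to moving the point of
  evaluation.\<close>

lemma rank_at_pullback:
  "x \<in> topspace X \<Longrightarrow> p \<in> Proj X \<Longrightarrow> rank_at (map_mat (pullback X k) p) x = rank_at p (k x)"
  using ProjD(3)[of p X] by (simp add: rank_at_def mat_trace_apply pullback_def)

lemma K0_class_closed [simp, intro]: "p \<in> Proj X \<Longrightarrow> K0_class X p \<in> carrier (K0 X)"
  by (simp add: K0_class_def K0_diff_closed)

lemma pcone_K0 [simp]: "pcone (K0 X) = K0_class X ` Proj X"
  by (simp add: K0_def)

section \<open>Classes of clopen sets\<close>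

definition clopen_proj :: "'a set \<Rightarrow> ('a \<Rightarrow> complex) mat" where
  "clopen_proj U = mat 1 1 (\<lambda>_ x. if x \<in> U then 1 else 0)"

lemma dim_clopen_proj [simp]: "dim_row (clopen_proj U) = 1" "dim_col (clopen_proj U) = 1"
  by (simp_all add: clopen_proj_def)

lemma clopen_proj_index [simp]: "clopen_proj U $$ (0, 0) = (\<lambda>x. if x \<in> U then 1 else 0)"
  by (simp add: clopen_proj_def)

lemma ounit_K0: "ounit (K0 X) = K0_class X (clopen_proj (topspace X))"
  by (simp add: K0_def clopen_proj_def CX_one_def)

lemma clopen_CX:
  assumes "openin X U" "closedin X U"
  shows "(\<lambda>x. if x \<in> U then 1 else 0) \<in> CX X"
proof -
  have U: "U \<subseteq> topspace X" using assms(1) by (rule openin_subset)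
  have "openin X {x \<in> topspace X. (if x \<in> U then 1 else 0 :: complex) \<in> W}" for W :: "complex set"
  proof -
    have "{x \<in> topspace X. (if x \<in> U then 1 else 0 :: complex) \<in> W} =
        (if 1 \<in> W then U else {}) \<union> (if 0 \<in> W then topspace X - U else {})"
      using U by auto
    then show ?thesis using assms by (auto simp: openin_diff)
  qed
  then show ?thesis using U by (auto simp: CX_def continuous_map_def)
qed

lemma clopen_proj_Proj:
  assumes "openin X U" "closedin X U"
  shows "clopen_proj U \<in> Proj X"
proof -
  have "clopen_proj U \<in> CX_mat X 1 1"
    using clopen_CX[OF assms] by (auto simp: CX_mat_def)
  moreover have "clopen_proj U * clopen_proj U = clopen_proj U" "star_mat (clopen_proj U) = clopen_proj U"
    by (auto intro!: eq_matI simp: scalar_prod_def fun_eq_iff)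
  ultimately show ?thesis unfolding Proj_def by blast
qed

lemma rank_at_clopen_proj [simp]: "rank_at (clopen_proj U) x = (if x \<in> U then 1 else 0)"
  by (simp add: rank_at_def mat_trace_apply)

definition clopen_class :: "'a topology \<Rightarrow> 'a set \<Rightarrow> 'a K0_elem" where
  "clopen_class X U = K0_class X (clopen_proj U)"

text \<open>Evaluation at a point of U separates the class from zero, since its rank there is
  1.\<close>

lemma clopen_class_ne_one:
  assumes "openin X U" "closedin X U" "U \<noteq> {}"
  shows "clopen_class X U \<noteq> \<one>\<^bsub>K0 X\<^esub>"
proof
  assume *: "clopen_class X U = \<one>\<^bsub>K0 X\<^esub>"
  obtain x where "x \<in> U" using assms(3) by blast
  then have "K0_rank X x (clopen_class X U) = 1"
    by (simp add: clopen_class_def K0_rank_class clopen_proj_Proj assms)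
  moreover have "K0_rank X x \<one>\<^bsub>K0 X\<^esub> = 0"
    by (simp add: K0_def K0_rank_class)
  ultimately show False using * by simp
qed

text \<open>The row \<open>(1\<^sub>U, 1\<^sub>V)\<close> implements the equivalence of \<open>1\<^sub>U \<oplus> 1\<^sub>V\<close> with \<open>1\<^sub>U + 1\<^sub>V\<close>.\<close>

lemma clopen_class_Un:
  assumes U: "openin X U" "closedin X U" and V: "openin X V" "closedin X V" and disj: "U \<inter> V = {}"
  shows "clopen_class X U \<otimes>\<^bsub>K0 X\<^esub> clopen_class X V = clopen_class X (U \<union> V)"
proof -
  have UV: "openin X (U \<union> V)" "closedin X (U \<union> V)" using U V by auto
  note P = clopen_proj_Proj[OF U] clopen_proj_Proj[OF V] clopen_proj_Proj[OF UV]
  define v where "v = mat 1 2 (\<lambda>(i, j) x. if x \<in> (if j = 0 then U else V) then 1 else (0 :: complex))"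
  have dims: "dim_row v = 1" "dim_col v = 2" by (simp_all add: v_def)
  have v_idx: "v $$ (0, j) = (\<lambda>x. if x \<in> (if j = 0 then U else V) then 1 else 0)" if "j < 2" for j
    using that by (simp add: v_def)
  have "v \<in> CX_mat X 1 2"
    using clopen_CX[OF U] clopen_CX[OF V] by (auto simp: CX_mat_def dims v_idx)
  \<comment> \<open>The off-diagonal entries are products of the two indicator functions and vanish
    by disjointness.\<close>
  moreover have "star_mat v * v = mat_dsum (clopen_proj U) (clopen_proj V)"
  proof (rule eq_matI)
    fix i j assume "i < dim_row (mat_dsum (clopen_proj U) (clopen_proj V))"
      "j < dim_col (mat_dsum (clopen_proj U) (clopen_proj V))"
    then have ij: "i < 2" "j < 2" by auto
    then have "((star_mat v * v) $$ (i, j)) x = (v $$ (0, i)) x * (v $$ (0, j)) x" for x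
      by (subst mult_mat_index_apply) (auto simp: dims v_idx)
    moreover have "mat_dsum (clopen_proj U) (clopen_proj V) $$ (i, j) =
       (if i = 0 then if j = 0 then clopen_proj U $$ (0, 0) else 0
        else if j = 0 then 0 else clopen_proj V $$ (0, 0))"
      using ij by (auto simp: mat_dsum_def less_2_cases_iff)
    ultimately show "(star_mat v * v) $$ (i, j) = mat_dsum (clopen_proj U) (clopen_proj V) $$ (i, j)"
      using ij disj by (auto simp: fun_eq_iff v_idx)
  qed (auto simp: dims)
  moreover have "v * star_mat v = clopen_proj (U \<union> V)"
  proof (rule eq_matI)
    fix i j assume "i < dim_row (clopen_proj (U \<union> V))" "j < dim_col (clopen_proj (U \<union> V))"
    then have ij: "i = 0" "j = 0" by auto
    have "((v * star_mat v) $$ (0, 0)) x = (\<Sum>k<2. (v $$ (0, k)) x * cnj ((v $$ (0, k)) x))" for x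
      by (subst mult_mat_index_apply) (auto simp: dims)
    then show "(v * star_mat v) $$ (i, j) = clopen_proj (U \<union> V) $$ (i, j)"
      using disj by (auto simp: fun_eq_iff ij v_idx numeral_2_eq_2)
  qed (auto simp: dims)
  ultimately have "MvN_equiv X (mat_dsum (clopen_proj U) (clopen_proj V)) (clopen_proj (U \<union> V))"
    unfolding MvN_equiv_def by (auto simp: numeral_2_eq_2)
  then have "MvN_class X (mat_dsum (clopen_proj U) (clopen_proj V)) = MvN_class X (clopen_proj (U \<union> V))"
    using MvN_class_eq_iff[OF Proj_dsum[OF P(1,2)] P(3)] by simp
  then have "K0_diff X (mat_dsum (clopen_proj U) (clopen_proj V)) (0\<^sub>m 0 0) = K0_diff X (clopen_proj (U \<union> V)) (0\<^sub>m 0 0)"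
    by (intro K0_diff_eqI Proj_dsum P Proj_zero) simp
  then show ?thesis
    using K0_mult[OF P(1) Proj_zero P(2) Proj_zero]
    by (simp add: clopen_class_def K0_class_def)
qed

lemma K0_map_clopen_class:
  assumes "continuous_map X X k" "openin X U" "closedin X U"
  shows "K0_map X (pullback X k) (clopen_class X U) = clopen_class X {x \<in> topspace X. k x \<in> U}"
proof -
  have "map_mat (pullback X k) (clopen_proj U) = clopen_proj {x \<in> topspace X. k x \<in> U}"
    by (rule eq_matI) (auto simp: pullback_def clopen_proj_def fun_eq_iff)
  then show ?thesis
    using K0_map_pullback_class[OF assms(1) clopen_proj_Proj[OF assms(2,3)]]
    by (simp add: clopen_class_def)
qed

section \<open>Compact zero-dimensional metric spaces\<close>

text \<open>One \<delta> for a whole finite set, by taking minima. It serves twice: for the ranks of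
  the classes in S, and for the homeomorphisms given by the elements of F.\<close>

lemma finite_uniform_delta:
  fixes \<rho> :: "'a \<Rightarrow> 'a \<Rightarrow> real"
  assumes "finite S"
    and "\<And>g. g \<in> S \<Longrightarrow> \<exists>\<delta>>0. \<forall>x\<in>M. \<forall>y\<in>M. \<rho> x y < \<delta> \<longrightarrow> Q g x y"
  shows "\<exists>\<delta>>0. \<forall>g\<in>S. \<forall>x\<in>M. \<forall>y\<in>M. \<rho> x y < \<delta> \<longrightarrow> Q g x y"
  using assms
proof (induction S)
  case empty
  then show ?case by (auto intro: exI[of _ 1])
next
  case (insert g S)
  then obtain \<delta> where \<delta>: "\<delta> > 0" "\<forall>g\<in>S. \<forall>x\<in>M. \<forall>y\<in>M. \<rho> x y < \<delta> \<longrightarrow> Q g x y"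
    by (metis insertCI)
  obtain \<delta>' where \<delta>': "\<delta>' > 0" "\<forall>x\<in>M. \<forall>y\<in>M. \<rho> x y < \<delta>' \<longrightarrow> Q g x y"
    using insert.prems[of g] by blast
  show ?case using \<delta> \<delta>' by (intro exI[of _ "min \<delta> \<delta>'"]) auto
qed

context Metric_space
begin

lemma compact_uniformly_continuous_euclidean:
  fixes f :: "'a \<Rightarrow> 'b::metric_space"
  assumes "compact_space mtopology" "continuous_map mtopology euclidean f" "\<epsilon> > 0"
  shows "\<exists>\<delta>>0. \<forall>x\<in>M. \<forall>y\<in>M. d x y < \<delta> \<longrightarrow> dist (f x) (f y) < \<epsilon>"
proof -
  have "uniformly_continuous_map (metric (M, d)) euclidean_metric f"
    using assms by (intro continuous_imp_uniformly_continuous_map) (simp add: mtopology_of_def)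
  then show ?thesis using \<open>\<epsilon> > 0\<close> by (simp add: uniformly_continuous_map_def) (metis commute dist_commute)
qed

lemma compact_uniformly_continuous_self:
  assumes "compact_space mtopology" "continuous_map mtopology mtopology f" "\<epsilon> > 0"
  shows "\<exists>\<delta>>0. \<forall>x\<in>M. \<forall>y\<in>M. d x y < \<delta> \<longrightarrow> d (f x) (f y) < \<epsilon>"
proof -
  have "uniformly_continuous_map (metric (M, d)) (metric (M, d)) f"
    using assms by (intro continuous_imp_uniformly_continuous_map) (simp add: mtopology_of_def)
  then show ?thesis using \<open>\<epsilon> > 0\<close> by (simp add: uniformly_continuous_map_def) (metis commute)
qed

end

text \<open>Each further set contributes only what the earlier ones miss, and differences of clopen
  sets are clopen. Some of the pieces may be empty.\<close>

lemma finite_clopen_disjoint_refinement: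
  assumes "finite \<V>" "\<And>V. V \<in> \<V> \<Longrightarrow> openin X V \<and> closedin X V"
  shows "\<exists>\<P>. finite \<P> \<and> (\<forall>U\<in>\<P>. openin X U \<and> closedin X U) \<and> (\<forall>U\<in>\<P>. \<exists>V\<in>\<V>. U \<subseteq> V) \<and>
    \<Union>\<P> = \<Union>\<V> \<and> disjoint \<P>"
  using assms
proof (induction \<V>)
  case empty
  then show ?case by (intro exI[of _ "{}"]) auto
next
  case (insert V \<V>)
  then obtain \<P> where P: "finite \<P>" "\<forall>U\<in>\<P>. openin X U \<and> closedin X U" "\<forall>U\<in>\<P>. \<exists>V\<in>\<V>. U \<subseteq> V"
    "\<Union>\<P> = \<Union>\<V>" "disjoint \<P>" by (metis insertCI)
  have "openin X (\<Union>\<P>)" "closedin X (\<Union>\<P>)"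
    using P(1,2) by (auto intro!: openin_Union closedin_Union)
  then have "openin X (V - \<Union>\<P>)" "closedin X (V - \<Union>\<P>)"
    using insert.prems[of V] by (auto intro: openin_diff closedin_diff)
  moreover have "disjoint (insert (V - \<Union>\<P>) \<P>)"
    using P(5) by (auto simp: pairwise_insert disjnt_def)
  ultimately show ?case using P(1-4)
    by (intro exI[of _ "insert (V - \<Union>\<P>) \<P>"]) auto
qed

lemma clopen_partition:
  assumes "compact_space X" "zero_dimensional_space X" "Metric_space (topspace X) \<rho>"
    and mt: "Metric_space.mtopology (topspace X) \<rho> = X" and "\<delta> > 0"
  obtains \<P> where "finite \<P>" "\<And>U. U \<in> \<P> \<Longrightarrow> openin X U \<and> closedin X U \<and> U \<noteq> {}"
    "\<And>U x y. U \<in> \<P> \<Longrightarrow> x \<in> U \<Longrightarrow> y \<in> U \<Longrightarrow> \<rho> x y < \<delta>" "\<Union>\<P> = topspace X" "disjoint \<P>"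
proof -
  interpret Metric_space "topspace X" \<rho> by fact
  \<comment> \<open>Radius \<delta>/2 bounds the distance between two points of the same set by
    \<delta>.\<close>
  define \<U> where "\<U> = {V. openin X V \<and> closedin X V \<and> (\<exists>x\<in>topspace X. V \<subseteq> mball x (\<delta> / 2))}"
  have "topspace X \<subseteq> \<Union>\<U>"
  proof
    fix x assume x: "x \<in> topspace X"
    have "openin X (mball x (\<delta> / 2))" using openin_mball[of x "\<delta> / 2"] unfolding mt .
    moreover have "x \<in> mball x (\<delta> / 2)" using x \<open>\<delta> > 0\<close> by simp
    ultimately obtain V where V: "openin X V" "closedin X V" "x \<in> V" "V \<subseteq> mball x (\<delta> / 2)"
      using assms(2)[unfolded zero_dimensional_space_def, rule_format, of "mball x (\<delta> / 2)" x] by blast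
    then have "V \<in> \<U>" using x unfolding \<U>_def by blast
    then show "x \<in> \<Union>\<U>" using V(3) by blast
  qed
  then obtain \<F> where F: "finite \<F>" "\<F> \<subseteq> \<U>" "topspace X \<subseteq> \<Union>\<F>"
    using assms(1)[unfolded compact_space_alt, rule_format, of \<U>] by (auto simp: \<U>_def)
  have "\<And>V. V \<in> \<F> \<Longrightarrow> openin X V \<and> closedin X V" using F(2) unfolding \<U>_def by blast
  from finite_clopen_disjoint_refinement[OF F(1) this] obtain \<P> where P: "finite \<P>"
    "\<forall>U\<in>\<P>. openin X U \<and> closedin X U" "\<forall>U\<in>\<P>. \<exists>V\<in>\<F>. U \<subseteq> V" "\<Union>\<P> = \<Union>\<F>" "disjoint \<P>"
    by auto
  have diam: "\<rho> x y < \<delta>" if U: "U \<in> \<P>" "x \<in> U" "y \<in> U" for U x y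
  proof -
    obtain V where "V \<in> \<F>" "U \<subseteq> V" using P(3) U(1) by blast
    moreover from this obtain z where "V \<subseteq> mball z (\<delta> / 2)" using F(2) unfolding \<U>_def by blast
    ultimately have z: "x \<in> mball z (\<delta> / 2)" "y \<in> mball z (\<delta> / 2)" using U(2,3) by blast+
    have "\<rho> x y \<le> \<rho> x z + \<rho> z y" by (rule triangle) (use z in auto)
    then show ?thesis using z commute[of x z] by simp
  qed
  have "\<Union>\<F> = topspace X"
    using F unfolding \<U>_def by (blast dest: openin_subset)
  \<comment> \<open>The empty piece is dropped because a point will be chosen in a cell, and every
    cell must have a nonzero class.\<close>
  then have "\<Union>(\<P> - {{}}) = topspace X" using P(4) by auto
  moreover have "disjoint (\<P> - {{}})" using P(5) by (rule pairwise_subset) auto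
  ultimately show thesis
    using P(1,2) diam by (intro that[of "\<P> - {{}}"]) blast+
qed

text \<open>Coordinates of \<open>Z_pow d\<close> are indexed by \<open>{..<d}\<close>, so the
  finite set E is replaced by \<open>{..<card E}\<close> and the action is conjugated by a
  bijection.\<close>

lemma residually_finite_actionE:
  assumes "residually_finite_action \<Gamma> M \<rho> h" "\<epsilon> > 0" "finite F" "F \<subseteq> carrier \<Gamma>"
  obtains d :: nat and \<theta> \<zeta> where "group_action \<Gamma> {..<d} \<theta>" "\<And>i. i < d \<Longrightarrow> \<zeta> i \<in> M"
    "\<And>s i. s \<in> F \<Longrightarrow> i < d \<Longrightarrow> \<rho> (\<zeta> (\<theta> s i)) (h s (\<zeta> i)) < \<epsilon>"
    "\<And>x. x \<in> M \<Longrightarrow> \<exists>i<d. \<rho> (\<zeta> i) x < \<epsilon>"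
proof -
  obtain E :: "nat set" and \<theta> \<zeta> where E: "finite E" "group_action \<Gamma> E \<theta>" "\<zeta> \<in> E \<rightarrow> M"
    and app: "\<forall>s\<in>F. \<forall>z\<in>E. \<rho> (\<zeta> (\<theta> s z)) (h s (\<zeta> z)) < \<epsilon>"
    and dense: "\<forall>x\<in>M. \<exists>z\<in>E. \<rho> (\<zeta> z) x < \<epsilon>"
    using assms(1)[unfolded residually_finite_action_def, THEN spec, THEN mp, OF assms(2),
        THEN spec, THEN mp, OF conjI[OF assms(3,4)]] by (elim exE conjE)
  interpret group_action \<Gamma> E \<theta> by fact
  interpret \<Gamma>: group \<Gamma> using group_hom by (rule group_hom.axioms(1))
  obtain b where b: "bij_betw b {..<card E} E"
    using ex_bij_betw_nat_finite[OF E(1)] by (auto simp: lessThan_atLeast0)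
  let ?D = "{..<card E}" and ?b' = "inv_into {..<card E} b"
  have bb: "\<And>i. i \<in> ?D \<Longrightarrow> b i \<in> E" "\<And>z. z \<in> E \<Longrightarrow> ?b' z \<in> ?D" "\<And>z. z \<in> E \<Longrightarrow> b (?b' z) = z"
    using bij_betwE[OF b] bij_betwE[OF bij_betw_inv_into[OF b]] bij_betw_inv_into_right[OF b] by auto
  have cl: "\<theta> s z \<in> E" if "s \<in> carrier \<Gamma>" "z \<in> E" for s z
    using that element_image by blast
  define \<theta>' where "\<theta>' s = (\<lambda>i\<in>?D. ?b' (\<theta> s (b i)))" for s
  have Bij: "\<theta>' s \<in> Bij ?D" if "s \<in> carrier \<Gamma>" for s
  proof -
    have "bij_betw (\<theta> s) E E" using bij_prop0[OF that] by (simp add: Bij_def)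
    from bij_betw_trans[OF bij_betw_trans[OF b this] bij_betw_inv_into[OF b]]
    have "bij_betw (\<theta>' s) ?D ?D"
      by (rule bij_betw_cong[THEN iffD1, rotated]) (simp add: \<theta>'_def)
    then show ?thesis by (simp add: Bij_def \<theta>'_def)
  qed
  have "\<theta>' (s \<otimes>\<^bsub>\<Gamma>\<^esub> t) = compose ?D (\<theta>' s) (\<theta>' t)" if "s \<in> carrier \<Gamma>" "t \<in> carrier \<Gamma>" for s t
  proof
    fix i
    show "\<theta>' (s \<otimes>\<^bsub>\<Gamma>\<^esub> t) i = compose ?D (\<theta>' s) (\<theta>' t) i"
    proof (cases "i \<in> ?D")
      case True
      then show ?thesis
        using that bb(1)[OF True] bb(2,3)[OF cl[OF that(2) bb(1)[OF True]]] composition_rule[OF bb(1)[OF True] that]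
        by (simp add: \<theta>'_def compose_def)
    qed (simp add: \<theta>'_def compose_def)
  qed
  then have "group_hom \<Gamma> (BijGroup ?D) \<theta>'"
    by (intro group_hom.intro group_hom_axioms.intro group_BijGroup homI)
      (simp_all add: BijGroup_def Bij \<Gamma>.is_group)
  then have act: "group_action \<Gamma> ?D \<theta>'" by (rule group_action.intro)
  show thesis
  proof (rule that[of "card E" \<theta>' "\<zeta> \<circ> b", OF act])
    show "(\<zeta> \<circ> b) i \<in> M" if "i < card E" for i
      using that bb(1)[of i] E(3) by auto
    show "\<rho> ((\<zeta> \<circ> b) (\<theta>' s i)) (h s ((\<zeta> \<circ> b) i)) < \<epsilon>" if "s \<in> F" "i < card E" for s i
    proof -
      have i: "b i \<in> E" and s: "s \<in> carrier \<Gamma>" using that bb(1) assms(4) by auto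
      then have "(\<zeta> \<circ> b) (\<theta>' s i) = \<zeta> (\<theta> s (b i))"
        using that(2) bb(3)[OF cl[OF s i]] by (simp add: \<theta>'_def)
      then show ?thesis using app that(1) i by simp
    qed
    show "\<exists>i<card E. \<rho> ((\<zeta> \<circ> b) i) x < \<epsilon>" if x: "x \<in> M" for x
    proof -
      obtain z where "z \<in> E" "\<rho> (\<zeta> z) x < \<epsilon>" using dense x by blast
      then show ?thesis using bb(2,3)[of z] by (intro exI[of _ "?b' z"]) auto
    qed
  qed
qed

section \<open>The equivalence\<close>

text \<open>The trace is uniformly continuous on a compact space, and integers at distance less than
  1 are equal.\<close>

lemma K0_rank_locally_constant:
  assumes "compact_space X" "Metric_space (topspace X) \<rho>" "Metric_space.mtopology (topspace X) \<rho> = X"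
    and "g \<in> pcone (K0 X)"
  shows "\<exists>\<delta>>0. \<forall>x\<in>topspace X. \<forall>y\<in>topspace X. \<rho> x y < \<delta> \<longrightarrow> K0_rank X x g = K0_rank X y g"
proof -
  interpret Metric_space "topspace X" \<rho> by fact
  obtain p where p: "p \<in> Proj X" "g = K0_class X p" using assms(4) by auto
  obtain \<delta> where \<delta>: "\<delta> > 0" "\<forall>x\<in>topspace X. \<forall>y\<in>topspace X. \<rho> x y < \<delta> \<longrightarrow> dist (mat_trace p x) (mat_trace p y) < 1"
    using compact_uniformly_continuous_euclidean[of "mat_trace p" 1] continuous_map_mat_trace[OF p(1)] assms(1,3)
    by auto
  have "rank_at p x = rank_at p y" if "dist (mat_trace p x) (mat_trace p y) < 1" for x y
  proof -
    have "dist (of_int (rank_at p x) :: complex) (of_int (rank_at p y)) < 1"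
      using that by (simp add: of_int_rank_at[OF p(1)])
    then have "\<bar>of_int (rank_at p x - rank_at p y) :: real\<bar> < 1"
      by (metis dist_norm norm_of_int of_int_diff)
    then show ?thesis by linarith
  qed
  then show ?thesis using \<delta> by (auto simp: p(2) K0_rank_class[OF p(1)])
qed

section \<open>From residual finiteness to exactly equivariant maps into \<int>^d\<close>

lemma residually_finite_imp_K0_models:
  fixes \<Gamma> :: "'g monoid"
  assumes "compact_space X" "Metric_space (topspace X) \<rho>" "Metric_space.mtopology (topspace X) \<rho> = X"
    and "continuous_group_action \<Gamma> X h"
    and rf: "residually_finite_action \<Gamma> (topspace X) \<rho> h"
    and S: "finite S" "S \<subseteq> pcone (K0 X)" and F: "finite F" "F \<subseteq> carrier \<Gamma>"
  shows "\<exists>d \<sigma> \<beta>. \<sigma> \<in> hom \<Gamma> (OAut (Z_pow d)) \<and> \<beta> \<in> unital_positive_hom (K0 X) (Z_pow d) \<and>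
    (\<forall>g\<in>S. \<forall>t\<in>F. \<beta> (K0_action \<Gamma> X h t g) = \<sigma> t (\<beta> g)) \<and>
    (\<forall>g\<in>S. g \<noteq> \<one>\<^bsub>K0 X\<^esub> \<longrightarrow> \<beta> g \<noteq> \<one>\<^bsub>Z_pow d\<^esub>)"
proof -
  interpret h: group_action \<Gamma> "topspace X" h
    using assms(4) by (simp add: continuous_group_action_def)
  interpret \<Gamma>: group \<Gamma> using h.group_hom by (rule group_hom.axioms(1))
  have cont: "continuous_map X X (h s)" if "s \<in> carrier \<Gamma>" for s
    using assms(4) that by (simp add: continuous_group_action_def)
  obtain \<delta> where "\<delta> > 0" and \<delta>: "\<forall>g\<in>S. \<forall>x\<in>topspace X. \<forall>y\<in>topspace X. \<rho> x y < \<delta> \<longrightarrow> K0_rank X x g = K0_rank X y g"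
    using finite_uniform_delta[OF S(1), of "topspace X" \<rho> "\<lambda>g x y. K0_rank X x g = K0_rank X y g"]
      K0_rank_locally_constant[OF assms(1-3)] S(2) by blast
  \<comment> \<open>Evaluating the t-translate of a class at x means evaluating the class at the
    inverse of t applied to x, and \<sigma> t reads coordinates through the same inverse. So the
    approximation is needed for the inverses of the elements of F.\<close>
  define F' where "F' = (\<lambda>t. inv\<^bsub>\<Gamma>\<^esub> t) ` F"
  have F': "finite F'" "F' \<subseteq> carrier \<Gamma>" using F by (auto simp: F'_def)
  obtain d :: nat and \<theta> \<zeta> where act: "group_action \<Gamma> {..<d} \<theta>" and \<zeta>: "\<And>i. i < d \<Longrightarrow> \<zeta> i \<in> topspace X"
    and app: "\<And>s i. s \<in> F' \<Longrightarrow> i < d \<Longrightarrow> \<rho> (\<zeta> (\<theta> s i)) (h s (\<zeta> i)) < \<delta>"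
    and dense: "\<And>x. x \<in> topspace X \<Longrightarrow> \<exists>i<d. \<rho> (\<zeta> i) x < \<delta>"
    using residually_finite_actionE[OF rf \<open>\<delta> > 0\<close> F'] by metis
  interpret \<theta>: group_action \<Gamma> "{..<d}" \<theta> by fact
  define \<sigma> where "\<sigma> t = Z_perm d (\<theta> (inv\<^bsub>\<Gamma>\<^esub> t))" for t
  define \<beta> where "\<beta> g = (\<lambda>i\<in>{..<d}. K0_rank X (\<zeta> i) g)" for g
  have S_carrier: "g \<in> carrier (K0 X)" if "g \<in> S" for g using that S(2) by auto
  have "\<sigma> \<in> hom \<Gamma> (OAut (Z_pow d))"
    unfolding \<sigma>_def by (rule action_imp_OAut_hom[OF act])
  moreover have "\<beta> \<in> unital_positive_hom (K0 X) (Z_pow d)"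
  proof -
    have "\<beta> \<in> hom (K0 X) (Z_pow d)"
      by (rule homI) (auto simp: \<beta>_def K0_rank_mult fun_eq_iff)
    moreover have "\<beta> ` pcone (K0 X) \<subseteq> pcone (Z_pow d)"
      by (auto simp: \<beta>_def K0_rank_class rank_at_nonneg split: if_splits)
    moreover have "\<beta> (ounit (K0 X)) = ounit (Z_pow d)"
      using \<zeta> by (auto simp: \<beta>_def ounit_K0 K0_rank_class clopen_proj_Proj fun_eq_iff)
    ultimately show ?thesis by (simp add: unital_positive_hom_def positive_hom_def)
  qed
  moreover have "\<beta> (K0_action \<Gamma> X h t g) = \<sigma> t (\<beta> g)" if g: "g \<in> S" and t: "t \<in> F" for g t
  proof -
    have t': "inv\<^bsub>\<Gamma>\<^esub> t \<in> carrier \<Gamma>" "inv\<^bsub>\<Gamma>\<^esub> t \<in> F'" using t F by (auto simp: F'_def)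
    obtain p where p: "p \<in> Proj X" "g = K0_class X p" using g S(2) by auto
    have "K0_rank X (\<zeta> i) (K0_action \<Gamma> X h t g) = K0_rank X (\<zeta> (\<theta> (inv\<^bsub>\<Gamma>\<^esub> t) i)) g" if i: "i < d" for i
    proof -
      have \<theta>i: "\<theta> (inv\<^bsub>\<Gamma>\<^esub> t) i < d" using \<theta>.element_image[of "inv\<^bsub>\<Gamma>\<^esub> t" i] i t' by auto
      have "h (inv\<^bsub>\<Gamma>\<^esub> t) (\<zeta> i) \<in> topspace X" using h.element_image[of "inv\<^bsub>\<Gamma>\<^esub> t" "\<zeta> i"] \<zeta>[OF i] t' by auto
      \<comment> \<open>The two points are closer than \<delta>, so the rank of g at them is the
        same integer; here approximate equivariance becomes exact.\<close>
      then have "K0_rank X (\<zeta> (\<theta> (inv\<^bsub>\<Gamma>\<^esub> t) i)) g = K0_rank X (h (inv\<^bsub>\<Gamma>\<^esub> t) (\<zeta> i)) g"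
        using \<delta> g \<zeta>[OF \<theta>i] app[OF t'(2) i] by blast
      also have "\<dots> = K0_rank X (\<zeta> i) (K0_action \<Gamma> X h t g)"
        using p \<zeta>[OF i] cont[OF t'(1)]
        by (simp add: K0_action_def CX_action_eq_pullback K0_map_pullback_class K0_rank_class
            map_mat_pullback_Proj rank_at_pullback)
      finally show ?thesis by simp
    qed
    then show ?thesis
      using \<theta>.element_image[OF t'(1)] by (auto simp: \<beta>_def \<sigma>_def Z_perm_def fun_eq_iff)
  qed
  moreover have "\<beta> g \<noteq> \<one>\<^bsub>Z_pow d\<^esub>" if g: "g \<in> S" "g \<noteq> \<one>\<^bsub>K0 X\<^esub>" for g
  proof -
    obtain p where p: "p \<in> Proj X" "g = K0_class X p" using g S(2) by auto
    then obtain x where x: "x \<in> topspace X" "K0_rank X x g \<noteq> 0"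
      using rank_at_zero_imp_class_one[OF p(1)] g(2) by (auto simp: K0_rank_class)
    \<comment> \<open>By density some coordinate sees the same nonzero rank as x does.\<close>
    obtain i where "i < d" "\<rho> (\<zeta> i) x < \<delta>" using dense[OF x(1)] by blast
    then have "K0_rank X (\<zeta> i) g \<noteq> 0" using \<delta> g(1) \<zeta> x by metis
    then show ?thesis using \<open>i < d\<close> by (auto simp: \<beta>_def fun_eq_iff)
  qed
  ultimately show ?thesis by blast
qed

lemma K0_action_closed:
  assumes "group \<Gamma>" "continuous_group_action \<Gamma> X h" "t \<in> carrier \<Gamma>" "g \<in> pcone (K0 X)"
  shows "K0_action \<Gamma> X h t g \<in> carrier (K0 X)"
proof -
  interpret group \<Gamma> by fact
  have "continuous_map X X (h (inv\<^bsub>\<Gamma>\<^esub> t))"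
    using assms(2,3) by (simp add: continuous_group_action_def)
  then show ?thesis
    using assms(4) by (auto simp: K0_action_def CX_action_eq_pullback K0_map_pullback_class map_mat_pullback_Proj)
qed

text \<open>The hypothesis is condition (3), applied below to the classes of the cells of a fine
  clopen partition. As \<beta> is additive only on H, every class that enters has to be shown to lie
  in H first.\<close>

lemma local_K0_models_imp_residually_finite:
  fixes \<Gamma> :: "'g monoid"
  assumes "compact_space X" "zero_dimensional_space X"
    and ms: "Metric_space (topspace X) \<rho>" and mt: "Metric_space.mtopology (topspace X) \<rho> = X"
    and "continuous_group_action \<Gamma> X h"
    and models: "\<And>S F. finite S \<Longrightarrow> S \<subseteq> pcone (K0 X) \<Longrightarrow> finite F \<Longrightarrow> F \<subseteq> carrier \<Gamma> \<Longrightarrow>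
      \<exists>d H \<sigma> \<beta>. subgroup H (K0 X) \<and> \<sigma> \<in> hom \<Gamma> (OAut (Z_pow d)) \<and>
        \<beta> \<in> positive_hom (ordered_subgroup (K0 X) H) (Z_pow d) \<and>
        ounit (K0 X) \<in> H \<and> K0_translates \<Gamma> X h S F \<subseteq> H \<and>
        \<beta> (ounit (K0 X)) = ounit (Z_pow d) \<and>
        (\<forall>g\<in>S. \<forall>t\<in>F. \<beta> (K0_action \<Gamma> X h t g) = \<sigma> t (\<beta> g)) \<and>
        (\<forall>g\<in>S. g \<noteq> \<one>\<^bsub>K0 X\<^esub> \<longrightarrow> \<beta> g \<noteq> \<one>\<^bsub>Z_pow d\<^esub>)"
  shows "residually_finite_action \<Gamma> (topspace X) \<rho> h"
  unfolding residually_finite_action_def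
proof (intro allI impI)
  fix \<epsilon> :: real and F assume "\<epsilon> > 0" and F: "finite F \<and> F \<subseteq> carrier \<Gamma>"
  interpret M: Metric_space "topspace X" \<rho> by fact
  interpret h: group_action \<Gamma> "topspace X" h
    using assms(5) by (simp add: continuous_group_action_def)
  interpret \<Gamma>: group \<Gamma> using h.group_hom by (rule group_hom.axioms(1))
  interpret K: comm_group "K0 X" by (rule comm_group_K0)
  have cont: "continuous_map X X (h s)" if "s \<in> carrier \<Gamma>" for s
    using assms(5) that by (simp add: continuous_group_action_def)
  have h_closed: "h s x \<in> topspace X" if "s \<in> carrier \<Gamma>" "x \<in> topspace X" for s x
    using that h.element_image by blast
  have "\<exists>\<delta>>0. \<forall>x\<in>topspace X. \<forall>y\<in>topspace X. \<rho> x y < \<delta> \<longrightarrow> \<rho> (h t x) (h t y) < \<epsilon> / 2" if "t \<in> F" for t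
    using M.compact_uniformly_continuous_self[of "h t" "\<epsilon> / 2"] assms(1) cont[of t] that F \<open>\<epsilon> > 0\<close>
    unfolding mt by auto
  then obtain \<delta>' where "\<delta>' > 0" and \<delta>': "\<forall>t\<in>F. \<forall>x\<in>topspace X. \<forall>y\<in>topspace X. \<rho> x y < \<delta>' \<longrightarrow> \<rho> (h t x) (h t y) < \<epsilon> / 2"
    using finite_uniform_delta[of F "topspace X" \<rho> "\<lambda>t x y. \<rho> (h t x) (h t y) < \<epsilon> / 2"] F by blast
  \<comment> \<open>The bound \<delta>' controls how far h t separates points of one cell, and
    \<epsilon>/2 is the diameter left for the cell of the image point; together they give \<epsilon>
    in the triangle inequality.\<close>
  define \<delta> where "\<delta> = min \<delta>' (\<epsilon> / 2)"
  have "\<delta> > 0" using \<open>\<delta>' > 0\<close> \<open>\<epsilon> > 0\<close> by (simp add: \<delta>_def)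
  obtain \<P> where P: "finite \<P>" "\<And>U. U \<in> \<P> \<Longrightarrow> openin X U \<and> closedin X U \<and> U \<noteq> {}"
    and diam: "\<And>U x y. U \<in> \<P> \<Longrightarrow> x \<in> U \<Longrightarrow> y \<in> U \<Longrightarrow> \<rho> x y < \<delta>" and cover: "\<Union>\<P> = topspace X"
    and disj: "disjoint \<P>"
    using clopen_partition[OF assms(1,2) ms mt \<open>\<delta> > 0\<close>] by metis
  define S where "S = clopen_class X ` \<P>"
  have S: "finite S" "S \<subseteq> pcone (K0 X)"
    using P by (auto simp: S_def clopen_class_def clopen_proj_Proj)
  from models[OF S conjunct1[OF F] conjunct2[OF F]] obtain d H \<sigma> \<beta> where H: "subgroup H (K0 X)" and \<sigma>: "\<sigma> \<in> hom \<Gamma> (OAut (Z_pow d))"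
    and \<beta>: "\<beta> \<in> positive_hom (ordered_subgroup (K0 X) H) (Z_pow d)"
    and unit: "ounit (K0 X) \<in> H" "\<beta> (ounit (K0 X)) = ounit (Z_pow d)"
    and trans: "K0_translates \<Gamma> X h S F \<subseteq> H"
    and equiv: "\<forall>g\<in>S. \<forall>t\<in>F. \<beta> (K0_action \<Gamma> X h t g) = \<sigma> t (\<beta> g)"
    and inj: "\<forall>g\<in>S. g \<noteq> \<one>\<^bsub>K0 X\<^esub> \<longrightarrow> \<beta> g \<noteq> \<one>\<^bsub>Z_pow d\<^esub>"
    by (elim exE conjE) (rule that)
  interpret H: subgroup H "K0 X" by fact
  let ?B = "\<lambda>U. \<beta> (clopen_class X U)"
  have \<beta>_mult: "\<beta> (z \<otimes>\<^bsub>K0 X\<^esub> w) i = \<beta> z i + \<beta> w i" if "z \<in> H" "w \<in> H" "i < d" for z w i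
    using hom_mult[of \<beta> "ordered_subgroup (K0 X) H" "Z_pow d" z w] \<beta> that
    by (simp add: positive_hom_def ordered_subgroup_def)
  have B_pcone: "?B U \<in> pcone (Z_pow d)" if "clopen_class X U \<in> H" "openin X U" "closedin X U" for U
    using \<beta> that by (auto simp: positive_hom_def ordered_subgroup_def clopen_class_def clopen_proj_Proj
        simp del: Z_pow_simps)
  then have B_nonneg: "?B U i \<ge> 0" if "clopen_class X U \<in> H" "openin X U" "closedin X U" "i < d" for U i
    using that by (auto dest: PiE_mem)
  have unit_clopen: "clopen_class X (topspace X) \<in> H" "i < d \<Longrightarrow> ?B (topspace X) i = 1" for i
    using unit by (simp_all add: ounit_K0 clopen_class_def)
  \<comment> \<open>The translate of U by t, written as a preimage under the inverse so that
    continuity makes it clopen. Its class is the image of the class of U under the action on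
    K_0.\<close>
  define W where "W t U = {x \<in> topspace X. h (inv\<^bsub>\<Gamma>\<^esub> t) x \<in> U}" for t U
  have W: "openin X (W t U)" "closedin X (W t U)" "K0_action \<Gamma> X h t (clopen_class X U) = clopen_class X (W t U)"
    if "t \<in> carrier \<Gamma>" "U \<in> \<P>" for t U
    using P(2)[OF that(2)] cont[of "inv\<^bsub>\<Gamma>\<^esub> t"] that(1) unfolding W_def
    by (auto simp: K0_action_def CX_action_eq_pullback K0_map_clopen_class
        intro: openin_continuous_map_preimage closedin_continuous_map_preimage)
  have W_H: "clopen_class X (W t U) \<in> H" if "t \<in> F \<union> {\<one>\<^bsub>\<Gamma>\<^esub>}" "U \<in> \<P>" for t U
  proof -
    have "K0_action \<Gamma> X h t (clopen_class X U) \<in> H"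
      using trans that by (auto simp: K0_translates_def S_def)
    then show ?thesis using W(3)[of t U] that F by auto
  qed
  \<comment> \<open>The translates include those by the neutral element, so the cells themselves
    have classes in H.\<close>
  have P_H: "clopen_class X U \<in> H" if "U \<in> \<P>" for U
  proof -
    have "W \<one>\<^bsub>\<Gamma>\<^esub> U = U"
      using cover that by (auto simp: W_def h.id_eq_one[symmetric])
    then show ?thesis using W_H[of "\<one>\<^bsub>\<Gamma>\<^esub>" U] that by simp
  qed
  have meet: "U \<inter> V \<noteq> {}" if U: "openin X U" "closedin X U" "clopen_class X U \<in> H" "?B U i \<ge> 1"
    and V: "openin X V" "closedin X V" "clopen_class X V \<in> H" "?B V i \<ge> 1" and i: "i < d" for U V i
  proof
    \<comment> \<open>With R the rest of the space, the classes of U, V and R add up to [1]. At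
      coordinate i this would give 1 on one side and at least 1 + 1 + 0 on the other.\<close>
    assume UV: "U \<inter> V = {}"
    let ?R = "topspace X - (U \<union> V)"
    have c: "openin X (U \<union> V)" "closedin X (U \<union> V)" "openin X ?R" "closedin X ?R"
      using U V by auto
    have "U \<union> V \<union> ?R = topspace X" using U V by (auto dest: openin_subset)
    then have sum: "clopen_class X (U \<union> V) \<otimes>\<^bsub>K0 X\<^esub> clopen_class X ?R = clopen_class X (topspace X)"
      using clopen_class_Un[OF c(1,2) c(3,4)] by simp
    have UV_eq: "clopen_class X (U \<union> V) = clopen_class X U \<otimes>\<^bsub>K0 X\<^esub> clopen_class X V"
      using clopen_class_Un[OF U(1,2) V(1,2) UV] by simp
    then have UV_H: "clopen_class X (U \<union> V) \<in> H" using U V by simp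
    have R_c: "clopen_class X ?R \<in> carrier (K0 X)"
      unfolding clopen_class_def by (rule K0_class_closed[OF clopen_proj_Proj[OF c(3,4)]])
    \<comment> \<open>R need not be a cell or a translate of one; its class lies in H only as a
      difference of elements of H.\<close>
    have "clopen_class X ?R = inv\<^bsub>K0 X\<^esub> clopen_class X (U \<union> V) \<otimes>\<^bsub>K0 X\<^esub> clopen_class X (topspace X)"
      unfolding sum[symmetric] using UV_H R_c by (simp add: K.m_assoc[symmetric])
    then have R_H: "clopen_class X ?R \<in> H" using UV_H unit_clopen(1) by simp
    have "1 = ?B (U \<union> V) i + ?B ?R i"
      using \<beta>_mult[OF UV_H R_H i] unit_clopen(2)[OF i] by (simp add: sum)
    also have "?B (U \<union> V) i = ?B U i + ?B V i"
      unfolding UV_eq by (rule \<beta>_mult[OF U(3) V(3) i])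
    finally show False using U(4) V(4) B_nonneg[OF R_H c(3,4) i] by simp
  qed
  have "\<exists>U\<in>\<P>. ?B U i \<ge> 1" if i: "i < d" for i
  proof (rule ccontr)
    assume "\<not> ?thesis"
    then have zero: "?B U i = 0" if "U \<in> \<P>" for U
      using that B_nonneg[OF P_H[OF that] _ _ i] P(2)[OF that] by force
    \<comment> \<open>Summing over the cells one at a time; membership in H is carried along because
      additivity of \<beta> requires it. For the full partition this contradicts the value 1 at the
      order unit.\<close>
    have "clopen_class X (\<Union>\<Q>) \<in> H \<and> ?B (\<Union>\<Q>) i = 0" if "\<Q> \<subseteq> \<P>" for \<Q>
      using finite_subset[OF that P(1)] that
    proof (induction \<Q>)
      case empty
      have "clopen_class X {} = \<one>\<^bsub>K0 X\<^esub>"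
        unfolding clopen_class_def by (rule rank_at_zero_imp_class_one) (simp_all add: clopen_proj_Proj)
      moreover have "\<beta> \<one>\<^bsub>K0 X\<^esub> i = 0"
        using \<beta>_mult[OF H.one_closed H.one_closed i] by simp
      ultimately show ?case by simp
    next
      case (insert U \<Q>)
      have "openin X (\<Union>\<Q>)" "closedin X (\<Union>\<Q>)"
        using insert P(2) by (auto intro!: openin_Union closedin_Union)
      moreover have "U \<inter> \<Union>\<Q> = {}"
        using insert disj by (fastforce simp: pairwise_def disjnt_def)
      ultimately have "clopen_class X (\<Union>(insert U \<Q>)) = clopen_class X U \<otimes>\<^bsub>K0 X\<^esub> clopen_class X (\<Union>\<Q>)"
        using clopen_class_Un[of X U "\<Union>\<Q>"] P(2)[of U] insert.prems by simp
      then show ?case using insert P_H[of U] zero[of U] \<beta>_mult[OF _ _ i] by simp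
    qed
    from this[OF subset_refl] show False using unit_clopen(2)[OF i] cover by simp
  qed
  then obtain C where C: "\<And>i. i < d \<Longrightarrow> C i \<in> \<P> \<and> ?B (C i) i \<ge> 1" by metis
  have "\<exists>x. x \<in> C i" if "i < d" for i using C[OF that] P(2) by blast
  then obtain \<zeta> where \<zeta>: "\<And>i. i < d \<Longrightarrow> \<zeta> i \<in> C i" by metis
  have \<zeta>_X: "\<zeta> i \<in> topspace X" if "i < d" for i using \<zeta>[OF that] C[OF that] cover by blast
  obtain \<theta> where act: "group_action \<Gamma> {..<d} \<theta>"
    and \<theta>: "\<And>t i. t \<in> carrier \<Gamma> \<Longrightarrow> i < d \<Longrightarrow> \<theta> t i < d \<and> \<sigma> t (Z_basis d i) = Z_basis d (\<theta> t i)"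
    using OAut_hom_imp_action[OF \<Gamma>.is_group \<sigma>] by metis
  have approx: "\<rho> (\<zeta> (\<theta> t i)) (h t (\<zeta> i)) < \<epsilon>" if t: "t \<in> F" and i: "i < d" for t i
  proof -
    have tc: "t \<in> carrier \<Gamma>" using t F by blast
    let ?j = "\<theta> t i"
    have j: "?j < d" and basis: "\<sigma> t (Z_basis d i) = Z_basis d ?j" using \<theta>[OF tc i] by auto
    have Ci: "C i \<in> \<P>" "?B (C i) i \<ge> 1" and Cj: "C ?j \<in> \<P>" "?B (C ?j) ?j \<ge> 1"
      using C i j by auto
    \<comment> \<open>The vector of the cell \<open>C i\<close> is at least the i-th basis vector,
      which \<sigma> t sends to the basis vector with index \<theta> t i.\<close>
    have "\<sigma> t (?B (C i)) ?j \<ge> 1"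
      using P(2)[OF Ci(1)] P_H[OF Ci(1)]
      by (intro OAut_basis_le[OF hom_in_carrier[OF \<sigma> tc] B_pcone i Ci(2) j basis]) auto
    moreover have "\<beta> (K0_action \<Gamma> X h t (clopen_class X (C i))) = \<sigma> t (?B (C i))"
      using equiv Ci(1) t unfolding S_def by blast
    ultimately have "?B (W t (C i)) ?j \<ge> 1"
      using W(3)[OF tc Ci(1)] by simp
    \<comment> \<open>Both the cell \<open>C ?j\<close> and the translate of \<open>C i\<close> are
      nonzero at coordinate \<open>?j\<close>, so they share a point y. It is close to \<zeta> ?j,
      and its preimage under t is close to \<zeta> i.\<close>
    then obtain y where y: "y \<in> C ?j" "y \<in> W t (C i)"
      using meet[of "C ?j" ?j "W t (C i)"] P(2)[OF Cj(1)] P_H[OF Cj(1)] Cj(2) W(1,2)[OF tc Ci(1)] W_H[of t "C i"] t Ci(1) j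
      by blast
    then have yX: "y \<in> topspace X" and y': "h (inv\<^bsub>\<Gamma>\<^esub> t) y \<in> C i" by (auto simp: W_def)
    have y'X: "h (inv\<^bsub>\<Gamma>\<^esub> t) y \<in> topspace X" using h_closed tc yX by simp
    have hy: "h t (h (inv\<^bsub>\<Gamma>\<^esub> t) y) = y"
      using h.composition_rule[OF yX tc, of "inv\<^bsub>\<Gamma>\<^esub> t"] tc yX by (simp add: h.id_eq_one[symmetric])
    have "\<rho> (h (inv\<^bsub>\<Gamma>\<^esub> t) y) (\<zeta> i) < \<delta>'"
      using diam[OF Ci(1) y' \<zeta>[OF i]] by (simp add: \<delta>_def)
    then have "\<rho> (h t (h (inv\<^bsub>\<Gamma>\<^esub> t) y)) (h t (\<zeta> i)) < \<epsilon> / 2"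
      using \<delta>' t y'X \<zeta>_X[OF i] by blast
    moreover have "\<rho> (\<zeta> ?j) y < \<epsilon> / 2"
      using diam[OF Cj(1) \<zeta>[OF j] y(1)] by (simp add: \<delta>_def)
    moreover have "\<rho> (\<zeta> ?j) (h t (\<zeta> i)) \<le> \<rho> (\<zeta> ?j) y + \<rho> y (h t (\<zeta> i))"
      using \<zeta>_X[OF j] yX h_closed[OF tc \<zeta>_X[OF i]] by (rule M.triangle)
    ultimately show ?thesis by (simp add: hy)
  qed
  have dense: "\<exists>i\<in>{..<d}. \<rho> (\<zeta> i) x < \<epsilon>" if x: "x \<in> topspace X" for x
  proof -
    obtain U where U: "U \<in> \<P>" "x \<in> U" using x cover by blast
    have Uc: "openin X U" "closedin X U" "U \<noteq> {}" using P(2)[OF U(1)] by auto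
    have "?B U \<noteq> \<one>\<^bsub>Z_pow d\<^esub>"
      using inj U(1) clopen_class_ne_one[OF Uc] unfolding S_def by blast
    moreover have "?B U \<in> {..<d} \<rightarrow>\<^sub>E {0..}" using B_pcone[OF P_H[OF U(1)] Uc(1,2)] by simp
    ultimately obtain i where i: "i < d" "?B U i \<noteq> 0"
      by (auto simp: fun_eq_iff PiE_iff extensional_def split: if_splits)
    then have "?B U i \<ge> 1" using B_nonneg[OF P_H[OF U(1)] Uc(1,2) i(1)] by simp
    \<comment> \<open>Two cells that meet coincide. Hence U is the cell in which \<zeta> i was
      chosen, so every cell contains a chosen point.\<close>
    then have "U \<inter> C i \<noteq> {}"
      using meet[of U i "C i"] Uc P_H U(1) C[OF i(1)] P(2)[of "C i"] i(1) by blast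
    then have "U = C i" using disj U(1) C[OF i(1)] by (auto simp: pairwise_def disjnt_def)
    then have "\<rho> (\<zeta> i) x < \<delta>" using diam[OF U(1) _ U(2)] \<zeta>[OF i(1)] by simp
    moreover have "\<delta> < \<epsilon>" using \<open>\<epsilon> > 0\<close> by (simp add: \<delta>_def)
    ultimately show ?thesis using i(1) by (intro bexI[of _ i]) auto
  qed
  show "\<exists>(E :: nat set) \<theta> \<zeta>. finite E \<and> group_action \<Gamma> E \<theta> \<and> \<zeta> \<in> E \<rightarrow> topspace X \<and>
           (\<forall>s\<in>F. \<forall>z\<in>E. \<rho> (\<zeta> (\<theta> s z)) (h s (\<zeta> z)) < \<epsilon>) \<and>
           (\<forall>x\<in>topspace X. \<exists>z\<in>E. \<rho> (\<zeta> z) x < \<epsilon>)"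
    using act approx dense \<zeta>_X
    by (intro exI[of _ "{..<d}"] exI[of _ \<theta>] exI[of _ \<zeta>]) auto
qed

theorem proposition4p1:
  fixes X :: "'a topology"
    and \<rho> :: "'a \<Rightarrow> 'a \<Rightarrow> real"
    and \<Gamma> :: "'g monoid"
    and h :: "'g \<Rightarrow> 'a \<Rightarrow> 'a"
  assumes "compact_space X"
    and "zero_dimensional_space X"
    and "Metric_space (topspace X) \<rho>"
    and "Metric_space.mtopology (topspace X) \<rho> = X"
    and "group \<Gamma>"
    and "countable (carrier \<Gamma>)"
    and "continuous_group_action \<Gamma> X h"
  defines "cond1 \<equiv> residually_finite_action \<Gamma> (topspace X) \<rho> h"
    and "cond2 \<equiv> (\<forall>S F. finite S \<and> S \<subseteq> pcone (K0 X) \<and> finite F \<and> F \<subseteq> carrier \<Gamma> \<longrightarrow>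
          (\<exists>(d::nat) \<sigma> \<beta>.
             \<sigma> \<in> hom \<Gamma> (OAut (Z_pow d)) \<and>
             \<beta> \<in> unital_positive_hom (K0 X) (Z_pow d) \<and>
             (\<forall>g\<in>S. \<forall>t\<in>F. \<beta> (K0_action \<Gamma> X h t g) = \<sigma> t (\<beta> g)) \<and>
             (\<forall>g\<in>S. g \<noteq> \<one>\<^bsub>K0 X\<^esub> \<longrightarrow> \<beta> g \<noteq> \<one>\<^bsub>Z_pow d\<^esub>)))"
    and "cond3 \<equiv> (\<forall>S F. finite S \<and> S \<subseteq> pcone (K0 X) \<and> finite F \<and> F \<subseteq> carrier \<Gamma> \<longrightarrow>
          (\<exists>(d::nat) H \<sigma> \<beta>.
             subgroup H (K0 X) \<and>
             \<sigma> \<in> hom \<Gamma> (OAut (Z_pow d)) \<and>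
             \<beta> \<in> positive_hom (ordered_subgroup (K0 X) H) (Z_pow d) \<and>
             ounit (K0 X) \<in> H \<and> K0_translates \<Gamma> X h S F \<subseteq> H \<and>
             \<beta> (ounit (K0 X)) = ounit (Z_pow d) \<and>
             (\<forall>g\<in>S. \<forall>t\<in>F. \<beta> (K0_action \<Gamma> X h t g) = \<sigma> t (\<beta> g)) \<and>
             (\<forall>g\<in>S. g \<noteq> \<one>\<^bsub>K0 X\<^esub> \<longrightarrow> \<beta> g \<noteq> \<one>\<^bsub>Z_pow d\<^esub>)))"
  shows "(cond1 \<longleftrightarrow> cond2) \<and> (cond2 \<longleftrightarrow> cond3)"
proof -
  interpret K: comm_group "K0 X" by (rule comm_group_K0)
  interpret \<Gamma>: group \<Gamma> by fact
  have 12: cond2 if cond1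
    unfolding cond2_def
  proof (intro allI impI; elim conjE)
    fix S F assume "finite S" "S \<subseteq> pcone (K0 X)" "finite F" "F \<subseteq> carrier \<Gamma>"
    from residually_finite_imp_K0_models[OF assms(1,3,4,7) that[unfolded cond1_def] this]
    show "\<exists>d \<sigma> \<beta>. \<sigma> \<in> hom \<Gamma> (OAut (Z_pow d)) \<and> \<beta> \<in> unital_positive_hom (K0 X) (Z_pow d) \<and>
      (\<forall>g\<in>S. \<forall>t\<in>F. \<beta> (K0_action \<Gamma> X h t g) = \<sigma> t (\<beta> g)) \<and>
      (\<forall>g\<in>S. g \<noteq> \<one>\<^bsub>K0 X\<^esub> \<longrightarrow> \<beta> g \<noteq> \<one>\<^bsub>Z_pow d\<^esub>)" .
  qed
  have 23: cond3 if cond2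
    unfolding cond3_def
  proof (intro allI impI; elim conjE)
    fix S F assume SF: "finite S" "S \<subseteq> pcone (K0 X)" "finite F" "F \<subseteq> carrier \<Gamma>"
    then obtain d \<sigma> \<beta> where \<sigma>: "\<sigma> \<in> hom \<Gamma> (OAut (Z_pow d))"
      and \<beta>: "\<beta> \<in> unital_positive_hom (K0 X) (Z_pow d)"
      and rest: "\<forall>g\<in>S. \<forall>t\<in>F. \<beta> (K0_action \<Gamma> X h t g) = \<sigma> t (\<beta> g)"
        "\<forall>g\<in>S. g \<noteq> \<one>\<^bsub>K0 X\<^esub> \<longrightarrow> \<beta> g \<noteq> \<one>\<^bsub>Z_pow d\<^esub>"
      using \<open>cond2\<close> unfolding cond2_def by metis
    \<comment> \<open>The subgroup H is taken to be all of K_0(C(X)).\<close>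
    have "\<beta> \<in> positive_hom (ordered_subgroup (K0 X) (carrier (K0 X))) (Z_pow d)"
      and "\<beta> (ounit (K0 X)) = ounit (Z_pow d)"
      using \<beta> by (auto simp: unital_positive_hom_def positive_hom_def ordered_subgroup_def hom_def
          simp del: Z_pow_simps pcone_K0)
    moreover have "ounit (K0 X) \<in> carrier (K0 X)"
      by (simp add: ounit_K0 K0_class_closed clopen_proj_Proj)
    moreover have "K0_translates \<Gamma> X h S F \<subseteq> carrier (K0 X)"
      using SF K0_action_closed[OF assms(5,7)] by (auto simp: K0_translates_def subset_iff simp del: pcone_K0)
    ultimately show "\<exists>d H \<sigma> \<beta>. subgroup H (K0 X) \<and> \<sigma> \<in> hom \<Gamma> (OAut (Z_pow d)) \<and>
        \<beta> \<in> positive_hom (ordered_subgroup (K0 X) H) (Z_pow d) \<and>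
        ounit (K0 X) \<in> H \<and> K0_translates \<Gamma> X h S F \<subseteq> H \<and>
        \<beta> (ounit (K0 X)) = ounit (Z_pow d) \<and>
        (\<forall>g\<in>S. \<forall>t\<in>F. \<beta> (K0_action \<Gamma> X h t g) = \<sigma> t (\<beta> g)) \<and>
        (\<forall>g\<in>S. g \<noteq> \<one>\<^bsub>K0 X\<^esub> \<longrightarrow> \<beta> g \<noteq> \<one>\<^bsub>Z_pow d\<^esub>)"
      using K.subgroup_self \<sigma> rest by blast
  qed
  have 31: cond1 if cond3
    unfolding cond1_def
    by (rule local_K0_models_imp_residually_finite[OF assms(1-4,7)])
      (use that[unfolded cond3_def] in simp)
  show ?thesis using 12 23 31 by blast
qed

end
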